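(* Let $1\le p<\infty$ and let $E$ be a discrete KB-space. Then every $p$-limited subset of $E$ is relatively $p$-compact. Thus every discrete KB-space has the $p$-GP property, and hence the weak $p$-GP property.
   Context: A KB-space is a Banach lattice in which every increasing norm bounded sequence of positive elements is norm convergent. A Banach lattice is discrete if for every $x>0$ there is an atom $a$ (an element $a>0$ such that $0\le y\le a$ implies $y=\lambda a$ for some scalar $\lambda$) with $0<a\le x$. A sequence $(x_n^* )_n$ in the dual $X^*$ of a Banach space $X$ is weak* $p$-summable if $(x_n^*(x))_n\in\ell_p$ for every $x\in X$. A subset $A$ of $X$ is $p$-limited if for every weak* $p$-summable sequence $(x_n^* )_n\subset X^*$ there is $(a_n)_n\in\ell_p$ with $|x_n^*(x)|\le a_n$ for all $x\in A$ and $n\in\mathbb{N}$. A bounded set $A\subset X$ is relatively $p$-compact if there is a norm $p$-summable sequence $(x_n)_n$ in $X$ (i.e. $\sum_n\|x_n\|^p<\infty$) such that $A\subseteq\{\sum_{j=1}^\infty\lambda_jx_j:(\lambda_j)_j\in B_{\ell_{p^*}}\}$, where $1/p+1/p^*=1$ and $B_{\ell_{p^*}}$ is the closed unit ball of $\ell_{p^*}$. $X$ has the $p$-GP property if every $p$-limited subset of $X$ is relatively $p$-compact; $X$ has the weak $p$-GP property if every $p$-limited subset of $X$ is relatively compact. *)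

theory Defs
  imports "HOL-Analysis.Analysis" "HOL-Library.Lattice_Algebras"
begin

section \<open>Banach lattices\<close>

text \<open>The class \<open>lattice_ab_group_add_abs\<close> contributes the lattice operations and the
  modulus \<open>\<bar>x\<bar> = sup x (- x)\<close>; \<open>ordered_real_vector\<close> makes the order a vector order.\<close>

class banach_lattice = banach + ordered_real_vector + lattice_ab_group_add_abs +
  assumes norm_mono_abs: "\<bar>x\<bar> \<le> \<bar>y\<bar> \<Longrightarrow> norm x \<le> norm y"

definition KB_space :: "'a::banach_lattice itself \<Rightarrow> bool" where
  "KB_space _ \<longleftrightarrow>
    (\<forall>x :: nat \<Rightarrow> 'a. incseq x \<and> (\<forall>n. 0 \<le> x n) \<and> bounded (range x) \<longrightarrow> convergent x)"

definition lattice_atom :: "'a::banach_lattice \<Rightarrow> bool" where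
  "lattice_atom a \<longleftrightarrow> 0 < a \<and> (\<forall>y. 0 \<le> y \<and> y \<le> a \<longrightarrow> (\<exists>c::real. y = c *\<^sub>R a))"

definition discrete_lattice :: "'a::banach_lattice itself \<Rightarrow> bool" where
  "discrete_lattice _ \<longleftrightarrow> (\<forall>x::'a. 0 < x \<longrightarrow> (\<exists>a. lattice_atom a \<and> a \<le> x))"

section \<open>The sequence spaces\<close>

text \<open>The exponent \<open>q\<close> is meant to range over \<open>1 \<le> q \<le> \<infinity>\<close>. Over this range, \<open>ell_norm q\<close> is the
  usual norm on \<open>ell q\<close>; outside \<open>ell q\<close> its value is meaningless.\<close>

definition ell :: "ereal \<Rightarrow> (nat \<Rightarrow> real) set" where
  "ell q = (if q = \<infinity> then {a. bounded (range a)}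
            else {a. summable (\<lambda>n. \<bar>a n\<bar> powr real_of_ereal q)})"

definition ell_norm :: "ereal \<Rightarrow> (nat \<Rightarrow> real) \<Rightarrow> real" where
  "ell_norm q a = (if q = \<infinity> then (SUP n. \<bar>a n\<bar>)
            else (\<Sum>n. \<bar>a n\<bar> powr real_of_ereal q) powr (1 / real_of_ereal q))"

definition ell_unit_ball :: "ereal \<Rightarrow> (nat \<Rightarrow> real) set" where
  "ell_unit_ball q = {a \<in> ell q. ell_norm q a \<le> 1}"

definition conjugate_exponent :: "real \<Rightarrow> ereal" where
  "conjugate_exponent p = (if p = 1 then \<infinity> else ereal (p / (p - 1)))"

lemma conjugate_exponent:
  assumes "1 \<le> p"
  shows "1 / ereal p + 1 / conjugate_exponent p = 1"
  using assms by (auto simp: conjugate_exponent_def one_ereal_def field_simps)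

section \<open>Limited and compact sets\<close>

definition weak_star_p_summable :: "real \<Rightarrow> (nat \<Rightarrow> 'a::banach \<Rightarrow>\<^sub>L real) \<Rightarrow> bool" where
  "weak_star_p_summable p f \<longleftrightarrow> (\<forall>x. (\<lambda>n. blinfun_apply (f n) x) \<in> ell (ereal p))"

definition p_limited :: "real \<Rightarrow> 'a::banach set \<Rightarrow> bool" where
  "p_limited p A \<longleftrightarrow>
    (\<forall>f :: nat \<Rightarrow> 'a \<Rightarrow>\<^sub>L real. weak_star_p_summable p f \<longrightarrow>
      (\<exists>a \<in> ell (ereal p). \<forall>x\<in>A. \<forall>n. \<bar>blinfun_apply (f n) x\<bar> \<le> a n))"

definition norm_p_summable :: "real \<Rightarrow> (nat \<Rightarrow> 'a::banach) \<Rightarrow> bool" where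
  "norm_p_summable p x \<longleftrightarrow> summable (\<lambda>n. norm (x n) powr p)"

definition relatively_p_compact :: "real \<Rightarrow> 'a::banach set \<Rightarrow> bool" where
  "relatively_p_compact p A \<longleftrightarrow> bounded A \<and>
    (\<exists>x. norm_p_summable p x \<and>
      A \<subseteq> {s. \<exists>l \<in> ell_unit_ball (conjugate_exponent p). (\<lambda>j. l j *\<^sub>R x j) sums s})"

definition p_GP_property :: "real \<Rightarrow> 'a::banach itself \<Rightarrow> bool" where
  "p_GP_property p _ \<longleftrightarrow> (\<forall>A::'a set. p_limited p A \<longrightarrow> relatively_p_compact p A)"

definition weak_p_GP_property :: "real \<Rightarrow> 'a::banach itself \<Rightarrow> bool" where
  "weak_p_GP_property p _ \<longleftrightarrow> (\<forall>A::'a set. p_limited p A \<longrightarrow> compact (closure A))"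

end

theory Submission imports Defs begin

text \<open>Let \<open>A\<close> be a \<open>p\<close>-limited subset of a discrete KB-space. The normalized atoms, together with
  the functionals that read off the coefficient of an atom, form a system of coordinates in which
  every finite sum of coordinates is a contractive projection \<open>proj F\<close>, in which a vector is
  determined by its coordinates, and which is boundedly complete: partial sums that stay bounded
  along an increasing sequence of finite sets converge. The last property is what the KB-condition
  says about atoms. The argument takes place in the locale \<open>boundedly_complete_system\<close>, which
  records these properties and forgets the order.

  A gliding hump turns the qualitative hypothesis on \<open>A\<close> into a constant \<open>C\<close>: if finitely many
  functionals satisfy \<open>\<Sum>\<bar>f\<^sub>i y\<bar>\<^sup>p \<le> \<parallel>y\<parallel>\<^sup>p\<close> for all \<open>y\<close>, then \<open>\<Sum>\<bar>f\<^sub>i x\<^sub>i\<bar>\<^sup>p \<le> C\<close> for all choices of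
  \<open>x\<^sub>i \<in> A\<close> (\<open>p_limited_imp_summing_bound\<close>). So evaluation on \<open>A\<close> is a \<open>p\<close>-summing operator.

  The heart of the proof is \<open>small_tail_summing_bound\<close>: the constant becomes arbitrarily small once
  the functionals are required to vanish on a suitable finite set of coordinates. Otherwise there
  are disjoint finite blocks \<open>G\<^sub>k\<close>, each with a constant above a fixed \<open>c > 0\<close>, and putting weighted
  copies of the offending families together yields
  \<open>c \<le> C \<cdot> sup (\<Sum>t\<^sub>k \<parallel>proj G\<^sub>k y\<parallel>\<^sup>p)\<close>, the supremum over the unit ball, for all convex weights \<open>t\<close>.
  The unit ball sits in a compact space of coefficient functions, on which \<open>\<parallel>proj G\<^sub>k y\<parallel>\<^sup>p\<close> tends
  to \<open>0\<close> pointwise by bounded completeness. By an argument of Simons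
  (\<open>null_sequence_convex_combination\<close>) some convex combination of these functions is uniformly
  small, a contradiction.

  On a finite block \<open>J\<close> with constant \<open>c\<close> the Pietsch domination theorem and the bipolar theorem
  give finitely many vectors \<open>z\<^sub>i\<close> with \<open>\<Sum>\<parallel>z\<^sub>i\<parallel>\<^sup>p \<le> 2c\<close> such that each \<open>proj J x\<close> with \<open>x \<in> A\<close> is a
  combination of the \<open>z\<^sub>i\<close> with coefficients in the unit ball of the dual sequence space
  (\<open>block_representation\<close>). Both theorems are needed in finite dimensions only, and both follow from
  one elementary minimax lemma, \<open>approachability\<close>. Finally \<open>p_limited_representation\<close> cuts the
  coordinates into consecutive blocks whose constants decrease so fast that the vectors of the
  \<open>k\<close>-th block may be multiplied by \<open>2\<^sup>k\<^sup>+\<^sup>1\<close> without destroying \<open>p\<close>-summability, while the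
  coefficients, divided by the same factor, form a single element of the dual unit ball. So \<open>A\<close>
  lies in the image of that ball under \<open>l \<mapsto> \<Sum>l\<^sub>j x\<^sub>j\<close>, which is compact.\<close>

section \<open>The dual unit ball of the p-th power sequence space\<close>

text \<open>The unit ball of \<open>\<ell>\<^bsub>p*\<^esub>\<close>, described by duality instead of by its norm. The description treats
  \<open>p = 1\<close> and \<open>p > 1\<close> alike, makes sense over every index type, and makes convexity and closedness
  immediate.\<close>

definition dual_ball :: "real \<Rightarrow> ('i \<Rightarrow> real) set" where
  "dual_ball p = {l. \<forall>F u. finite F \<longrightarrow>
     \<bar>\<Sum>i\<in>F. l i * u i\<bar> \<le> (\<Sum>i\<in>F. \<bar>u i\<bar> powr p) powr (1 / p)}"

lemma dual_ballD:
  "l \<in> dual_ball p \<Longrightarrow> finite F \<Longrightarrow> \<bar>\<Sum>i\<in>F. l i * u i\<bar> \<le> (\<Sum>i\<in>F. \<bar>u i\<bar> powr p) powr (1 / p)"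
  by (auto simp: dual_ball_def)

lemma dual_ballI:
  "(\<And>F u. finite F \<Longrightarrow> \<bar>\<Sum>i\<in>F. l i * u i\<bar> \<le> (\<Sum>i\<in>F. \<bar>u i\<bar> powr p) powr (1 / p))
    \<Longrightarrow> l \<in> dual_ball p"
  by (auto simp: dual_ball_def)

lemma dual_ball_coord: "l \<in> dual_ball p \<Longrightarrow> \<bar>l i\<bar> \<le> 1"
  using dual_ballD[of l p "{i}" "\<lambda>_. 1"] by simp

text \<open>For \<open>p > 1\<close> test the duality against \<open>u\<^sub>i = sgn l\<^sub>i \<bar>l\<^sub>i\<bar>\<^sup>q\<^sup>-\<^sup>1\<close> with \<open>q\<close> the conjugate exponent: the
  sum \<open>s\<close> of the \<open>\<bar>l\<^sub>i\<bar>\<^sup>q\<close> then satisfies \<open>s \<le> s\<^sup>1\<^sup>/\<^sup>p\<close>, hence \<open>s \<le> 1\<close>.\<close>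

lemma dual_ball_subset_ell_unit_ball:
  assumes "1 \<le> p" "l \<in> dual_ball p"
  shows "l \<in> ell_unit_ball (conjugate_exponent p)"
proof (cases "p = 1")
  case True
  have "\<bar>l i\<bar> \<le> 1" for i
    using assms(2) by (rule dual_ball_coord)
  then have "bounded (range l)" "(SUP n. \<bar>l n\<bar>) \<le> 1"
    by (auto simp: bounded_iff intro!: exI[of _ 1] cSUP_least)
  then show ?thesis
    using True by (simp add: ell_unit_ball_def conjugate_exponent_def ell_def ell_norm_def)
next
  case False
  define q where "q = p / (p - 1)"
  have p: "p > 1" using assms False by auto
  have q: "q > 0" "q = (q - 1) * p" "1 - 1 / p = 1 / q"
    using p by (auto simp: q_def field_simps)
  have bound: "(\<Sum>i\<in>F. \<bar>l i\<bar> powr q) \<le> 1" if F: "finite F" for F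
  proof -
    define s where "s = (\<Sum>i\<in>F. \<bar>l i\<bar> powr q)"
    define u where "u i = sgn (l i) * \<bar>l i\<bar> powr (q - 1)" for i
    have "l i * u i = \<bar>l i\<bar> powr q" for i
      using powr_add[of "\<bar>l i\<bar>" 1 "q - 1"] by (auto simp: u_def sgn_if)
    moreover have "\<bar>u i\<bar> powr p = \<bar>l i\<bar> powr q" for i
    proof (cases "l i = 0")
      case False
      then show ?thesis
        using q by (simp add: u_def abs_mult powr_powr powr_mult)
    qed (use p q in \<open>auto simp: u_def\<close>)
    ultimately have "\<bar>s\<bar> \<le> s powr (1 / p)"
      using dual_ballD[OF assms(2) F, of u] by (simp add: s_def)
    moreover have s0: "s \<ge> 0" unfolding s_def by (intro sum_nonneg) auto
    ultimately have *: "s \<le> s powr (1 / p)" by simp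
    show ?thesis
    proof (rule ccontr)
      assume "\<not> ?thesis"
      then have "s > 1" by (simp add: s_def)
      then have "s powr (1/p) < s powr 1"
        using p by (intro powr_less_mono) auto
      with * \<open>s > 1\<close> show False by simp
    qed
  qed
  have nonneg: "\<And>i. \<bar>l i\<bar> powr q \<ge> 0" by simp
  have summ: "summable (\<lambda>i. \<bar>l i\<bar> powr q)"
    by (rule bounded_imp_summable[where B=1]) (auto intro!: bound)
  have "(\<Sum>i. \<bar>l i\<bar> powr q) \<le> 1"
    by (rule suminf_le_const[OF summ]) (auto intro!: bound)
  then have "(\<Sum>i. \<bar>l i\<bar> powr q) powr (1 / q) \<le> 1 powr (1 / q)"
    using q suminf_nonneg[OF summ nonneg] by (intro powr_mono2) auto
  with summ show ?thesis
    using False by (simp add: ell_unit_ball_def conjugate_exponent_def ell_def ell_norm_def q_def)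
qed

text \<open>The normalized Hoelder inequality, with the exponents arranged so that \<open>p = 1\<close> is included. The
  factor \<open>sgn (v i)\<close> makes the term vanish where \<open>v i = 0\<close>.\<close>

lemma sum_mult_powr_le:
  fixes v u :: "'i \<Rightarrow> real"
  assumes p: "1 \<le> p" and F: "finite F"
    and V: "(\<Sum>i\<in>F. \<bar>v i\<bar> powr p) \<le> 1" and U: "(\<Sum>i\<in>F. \<bar>u i\<bar> powr p) \<le> 1"
  shows "(\<Sum>i\<in>F. \<bar>sgn (v i) * \<bar>v i\<bar> powr (p - 1)\<bar> * \<bar>u i\<bar>) \<le> 1"
proof -
  have "\<bar>sgn (v i) * \<bar>v i\<bar> powr (p - 1)\<bar> * \<bar>u i\<bar> \<le> (1 - 1 / p) * \<bar>v i\<bar> powr p + (1 / p) * \<bar>u i\<bar> powr p" for i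
  proof (cases "v i = 0 \<or> u i = 0")
    case True
    then show ?thesis using p by auto
  next
    case False
    then have "(\<bar>v i\<bar> powr p) powr (1 - 1 / p) * (\<bar>u i\<bar> powr p) powr (1 / p)
        \<le> (1 - 1 / p) * \<bar>v i\<bar> powr p + (1 / p) * \<bar>u i\<bar> powr p"
      using p by (intro Youngs_inequality_0) auto
    moreover have "p * (1 - 1 / p) = p - 1" using p by (simp add: field_simps)
    ultimately show ?thesis using False p by (simp add: powr_powr abs_mult)
  qed
  then have "(\<Sum>i\<in>F. \<bar>sgn (v i) * \<bar>v i\<bar> powr (p - 1)\<bar> * \<bar>u i\<bar>)
      \<le> (\<Sum>i\<in>F. (1 - 1 / p) * \<bar>v i\<bar> powr p + (1 / p) * \<bar>u i\<bar> powr p)"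
    by (rule sum_mono)
  also have "\<dots> = (1 - 1 / p) * (\<Sum>i\<in>F. \<bar>v i\<bar> powr p) + (1 / p) * (\<Sum>i\<in>F. \<bar>u i\<bar> powr p)"
    by (simp add: sum.distrib sum_distrib_left)
  also have "\<dots> \<le> (1 - 1 / p) * 1 + (1 / p) * 1"
    using p U V by (intro add_mono mult_left_mono) auto
  finally show ?thesis by simp
qed

lemma sum_powr_normalize:
  fixes u :: "'i \<Rightarrow> real"
  assumes p: "1 \<le> p" and "U > 0" and "U = (\<Sum>i\<in>F. \<bar>u i\<bar> powr p)"
  shows "(\<Sum>i\<in>F. \<bar>u i / U powr (1 / p)\<bar> powr p) = 1"
proof -
  have "(\<Sum>i\<in>F. \<bar>u i / U powr (1 / p)\<bar> powr p) = (\<Sum>i\<in>F. \<bar>u i\<bar> powr p / U)"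
    using p assms(2) by (intro sum.cong) (auto simp: powr_divide powr_powr)
  also have "\<dots> = 1" using assms by (simp flip: sum_divide_distrib)
  finally show ?thesis .
qed

text \<open>The extremal case of the Hoelder inequality: every vector of \<open>\<ell>\<^sub>p\<close> with finite support is normed
  by an element of the dual ball.\<close>

lemma dual_ball_norming:
  fixes v :: "'i \<Rightarrow> real"
  assumes p: "1 \<le> p" and F: "finite F"
  obtains l where "l \<in> dual_ball p" "(\<Sum>i\<in>F. l i * v i) = (\<Sum>i\<in>F. \<bar>v i\<bar> powr p) powr (1 / p)"
proof (cases "(\<Sum>i\<in>F. \<bar>v i\<bar> powr p) = 0")
  case True
  then have "(\<Sum>i\<in>F. 0 * v i) = (\<Sum>i\<in>F. \<bar>v i\<bar> powr p) powr (1 / p)" by simp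
  then show ?thesis using that[of "\<lambda>_. 0"] by (simp add: dual_ball_def)
next
  case False
  define V where "V = (\<Sum>i\<in>F. \<bar>v i\<bar> powr p)"
  have V: "V > 0" using False by (simp add: V_def less_le sum_nonneg)
  define w where "w i = v i / V powr (1 / p)" for i
  have w1: "(\<Sum>i\<in>F. \<bar>w i\<bar> powr p) = 1"
    unfolding w_def using p V V_def by (rule sum_powr_normalize)
  define l where "l i = (if i \<in> F then sgn (w i) * \<bar>w i\<bar> powr (p - 1) else 0)" for i
  have "l \<in> dual_ball p"
  proof (rule dual_ballI)
    fix G :: "'i set" and u :: "'i \<Rightarrow> real"
    assume G: "finite G"
    define U where "U = (\<Sum>i\<in>G. \<bar>u i\<bar> powr p)"
    show "\<bar>\<Sum>i\<in>G. l i * u i\<bar> \<le> U powr (1 / p)"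
    proof (cases "U = 0")
      case True
      then have "\<forall>i\<in>G. u i = 0"
        using G by (simp add: U_def sum_nonneg_eq_0_iff)
      then show ?thesis by simp
    next
      case False
      then have U: "U > 0" by (simp add: U_def less_le sum_nonneg)
      define z where "z i = u i / U powr (1 / p)" for i
      have z1: "(\<Sum>i\<in>G. \<bar>z i\<bar> powr p) = 1"
        unfolding z_def using p U U_def by (rule sum_powr_normalize)
      have "\<bar>\<Sum>i\<in>G. l i * z i\<bar> \<le> (\<Sum>i\<in>G. \<bar>l i * z i\<bar>)" by (rule sum_abs)
      also have "\<dots> = (\<Sum>i\<in>G \<inter> F. \<bar>sgn (w i) * \<bar>w i\<bar> powr (p - 1)\<bar> * \<bar>z i\<bar>)"
        using G by (intro sum.mono_neutral_cong_right) (auto simp: l_def abs_mult)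
      also have "\<dots> \<le> 1"
      proof (rule sum_mult_powr_le[OF p])
        have "(\<Sum>i\<in>G \<inter> F. \<bar>w i\<bar> powr p) \<le> (\<Sum>i\<in>F. \<bar>w i\<bar> powr p)"
          using F by (intro sum_mono2) auto
        then show "(\<Sum>i\<in>G \<inter> F. \<bar>w i\<bar> powr p) \<le> 1" using w1 by simp
        have "(\<Sum>i\<in>G \<inter> F. \<bar>z i\<bar> powr p) \<le> (\<Sum>i\<in>G. \<bar>z i\<bar> powr p)"
          using G by (intro sum_mono2) auto
        then show "(\<Sum>i\<in>G \<inter> F. \<bar>z i\<bar> powr p) \<le> 1" using z1 by simp
      qed (use F in auto)
      finally have "\<bar>\<Sum>i\<in>G. l i * z i\<bar> \<le> 1" .
      moreover have "(\<Sum>i\<in>G. l i * z i) = (\<Sum>i\<in>G. l i * u i) / U powr (1 / p)"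
        by (simp add: z_def sum_divide_distrib)
      ultimately show ?thesis using U by (simp add: abs_divide field_simps)
    qed
  qed
  moreover have "(\<Sum>i\<in>F. l i * v i) = V powr (1 / p)"
  proof -
    have "l i * v i = V powr (1 / p) * \<bar>w i\<bar> powr p" if "i \<in> F" for i
    proof -
      have "v i = V powr (1 / p) * w i" using V by (simp add: w_def)
      moreover have "sgn (w i) * w i * \<bar>w i\<bar> powr (p - 1) = \<bar>w i\<bar> powr p"
        using powr_add[of "\<bar>w i\<bar>" 1 "p - 1"] by (auto simp: sgn_if)
      ultimately show ?thesis using that by (simp add: l_def algebra_simps)
    qed
    then have "(\<Sum>i\<in>F. l i * v i) = V powr (1 / p) * (\<Sum>i\<in>F. \<bar>w i\<bar> powr p)"
      by (simp add: sum_distrib_left)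
    with w1 show ?thesis by simp
  qed
  ultimately show ?thesis using that by (simp add: V_def)
qed

lemma dual_ball_average:
  fixes l :: "nat \<Rightarrow> 'i \<Rightarrow> real"
  assumes "T > 0" "\<And>k. k < T \<Longrightarrow> l k \<in> dual_ball p"
  shows "(\<lambda>i. (\<Sum>k<T. l k i) / real T) \<in> dual_ball p"
proof (rule dual_ballI)
  fix F :: "'i set" and u :: "'i \<Rightarrow> real"
  assume F: "finite F"
  let ?U = "(\<Sum>i\<in>F. \<bar>u i\<bar> powr p) powr (1 / p)"
  have "(\<Sum>i\<in>F. (\<Sum>k<T. l k i) / real T * u i) = (\<Sum>i\<in>F. \<Sum>k<T. l k i * u i) / real T"
    by (simp add: sum_divide_distrib sum_distrib_right)
  also have "\<dots> = (\<Sum>k<T. \<Sum>i\<in>F. l k i * u i) / real T"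
    by (subst sum.swap) simp
  finally have eq: "(\<Sum>i\<in>F. (\<Sum>k<T. l k i) / real T * u i) = (\<Sum>k<T. \<Sum>i\<in>F. l k i * u i) / real T" .
  have "\<bar>\<Sum>k<T. \<Sum>i\<in>F. l k i * u i\<bar> \<le> (\<Sum>k<T. \<bar>\<Sum>i\<in>F. l k i * u i\<bar>)"
    by (rule sum_abs)
  also have "\<dots> \<le> (\<Sum>k<T. ?U)"
    using F assms by (intro sum_mono dual_ballD) auto
  finally have "\<bar>\<Sum>k<T. \<Sum>i\<in>F. l k i * u i\<bar> \<le> real T * ?U" by simp
  then show "\<bar>\<Sum>i\<in>F. (\<Sum>k<T. l k i) / real T * u i\<bar> \<le> ?U"
    unfolding eq using assms(1) by (simp add: abs_divide field_simps)
qed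

lemma dual_ball_reindex:
  fixes g :: "'j \<Rightarrow> 'i" and l :: "'i \<Rightarrow> real"
  assumes "inj g" "l \<in> dual_ball p"
  shows "l \<circ> g \<in> dual_ball p"
proof (rule dual_ballI)
  fix F :: "'j set" and u :: "'j \<Rightarrow> real"
  assume F: "finite F"
  have "\<bar>\<Sum>j\<in>g ` F. l j * u (inv g j)\<bar> \<le> (\<Sum>j\<in>g ` F. \<bar>u (inv g j)\<bar> powr p) powr (1 / p)"
    using F assms by (intro dual_ballD) auto
  also have "(\<Sum>j\<in>g ` F. l j * u (inv g j)) = (\<Sum>i\<in>F. (l \<circ> g) i * u i)"
    using assms(1) by (subst sum.reindex) (auto intro: inj_on_subset)
  also have "(\<Sum>j\<in>g ` F. \<bar>u (inv g j)\<bar> powr p) = (\<Sum>i\<in>F. \<bar>u i\<bar> powr p)"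
    using assms(1) by (subst sum.reindex) (auto intro: inj_on_subset)
  finally show "\<bar>\<Sum>i\<in>F. (l \<circ> g) i * u i\<bar> \<le> (\<Sum>i\<in>F. \<bar>u i\<bar> powr p) powr (1 / p)" .
qed

text \<open>Elements of countably many dual balls fit into one after division by \<open>2\<^sup>k\<^sup>+\<^sup>1\<close>, because each pairing
  is bounded by the norm of the full vector and the factors sum to at most \<open>1\<close>.\<close>

lemma dual_ball_glue:
  fixes l :: "nat \<Rightarrow> 'i \<Rightarrow> real"
  assumes p: "1 \<le> p" and l: "\<And>k. l k \<in> dual_ball p"
  shows "(\<lambda>(k, i). l k i / 2 ^ Suc k) \<in> dual_ball p"
proof (rule dual_ballI)
  fix F :: "(nat \<times> 'i) set" and u :: "nat \<times> 'i \<Rightarrow> real"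
  assume F: "finite F"
  obtain N where N: "fst ` F \<subseteq> {..<N}"
    using finite_nat_iff_bounded[of "fst ` F"] F by auto
  define I where "I = snd ` F"
  have I: "finite I" "F \<subseteq> {..<N} \<times> I" using F N by (force simp: I_def)+
  define w where "w x = (if x \<in> F then u x else 0)" for x
  define U where "U = (\<Sum>x\<in>F. \<bar>u x\<bar> powr p) powr (1 / p)"
  have "(\<Sum>x\<in>F. (case x of (k, i) \<Rightarrow> l k i / 2 ^ Suc k) * u x)
      = (\<Sum>x\<in>{..<N} \<times> I. (case x of (k, i) \<Rightarrow> l k i / 2 ^ Suc k) * w x)"
    using I by (intro sum.mono_neutral_cong_left) (auto simp: w_def)
  also have "\<dots> = (\<Sum>k<N. \<Sum>i\<in>I. l k i / 2 ^ Suc k * w (k, i))"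
    by (simp add: sum.cartesian_product case_prod_unfold)
  also have "\<dots> = (\<Sum>k<N. (1 / 2 ^ Suc k) * (\<Sum>i\<in>I. l k i * w (k, i)))"
    by (simp add: sum_distrib_left sum_divide_distrib field_simps)
  finally have "\<bar>\<Sum>x\<in>F. (case x of (k, i) \<Rightarrow> l k i / 2 ^ Suc k) * u x\<bar>
      \<le> (\<Sum>k<N. (1 / 2 ^ Suc k) * \<bar>\<Sum>i\<in>I. l k i * w (k, i)\<bar>)"
    using sum_abs[of "\<lambda>k. (1 / 2 ^ Suc k) * (\<Sum>i\<in>I. l k i * w (k, i))" "{..<N}"]
    by (simp add: abs_mult)
  also have "\<dots> \<le> (\<Sum>k<N. (1 / 2 ^ Suc k) * U)"
  proof (intro sum_mono mult_left_mono)
    fix k assume k: "k \<in> {..<N}"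
    have "\<bar>\<Sum>i\<in>I. l k i * w (k, i)\<bar> \<le> (\<Sum>i\<in>I. \<bar>w (k, i)\<bar> powr p) powr (1 / p)"
      by (rule dual_ballD[OF l I(1)])
    also have "\<dots> \<le> U"
      unfolding U_def
    proof (rule powr_mono2)
      have "(\<Sum>i\<in>I. \<bar>w (k, i)\<bar> powr p) = (\<Sum>x\<in>{k} \<times> I. \<bar>w x\<bar> powr p)"
        by (simp add: sum.cartesian_product' flip: sum.cartesian_product)
      also have "\<dots> \<le> (\<Sum>x\<in>{..<N} \<times> I. \<bar>w x\<bar> powr p)"
        using k I by (intro sum_mono2) auto
      also have "\<dots> = (\<Sum>x\<in>F. \<bar>u x\<bar> powr p)"
        using I p by (intro sum.mono_neutral_cong_right) (auto simp: w_def)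
      finally show "(\<Sum>i\<in>I. \<bar>w (k, i)\<bar> powr p) \<le> (\<Sum>x\<in>F. \<bar>u x\<bar> powr p)" .
    qed (use p in \<open>auto intro!: sum_nonneg\<close>)
    finally show "\<bar>\<Sum>i\<in>I. l k i * w (k, i)\<bar> \<le> U" .
  qed auto
  also have "\<dots> = (\<Sum>k<N. 1 / 2 ^ Suc k) * U"
    by (rule sum_distrib_right[symmetric])
  also have "\<dots> \<le> 1 * U"
  proof (rule mult_right_mono)
    have "(\<Sum>k<N. 1 / 2 ^ Suc k :: real) = 1 - 1 / 2 ^ N"
      by (induction N) (auto simp: field_simps)
    then show "(\<Sum>k<N. 1 / 2 ^ Suc k :: real) \<le> 1" by simp
  qed (simp add: U_def)
  finally show "\<bar>\<Sum>x\<in>F. (case x of (k, i) \<Rightarrow> l k i / 2 ^ Suc k) * u x\<bar>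
      \<le> (\<Sum>x\<in>F. \<bar>u x\<bar> powr p) powr (1 / p)" by (simp add: U_def)
qed

lemma compact_cube: "compact (PiE UNIV (\<lambda>_. {-1..1}) :: ('i \<Rightarrow> real) set)"
proof -
  have "compactin (product_topology (\<lambda>_::'i. euclideanreal) UNIV) (PiE UNIV (\<lambda>_. {-1..1}))"
    by (simp add: compactin_PiE)
  then show ?thesis by (simp add: euclidean_product_topology)
qed

text \<open>Compactness is meant in the product topology, where the dual ball is a closed subset of a cube.\<close>

lemma compact_dual_ball: "compact (dual_ball p :: ('i \<Rightarrow> real) set)"
proof -
  have "closed (dual_ball p :: ('i \<Rightarrow> real) set)"
  proof -
    have "dual_ball p = (\<Inter>F\<in>Collect finite. \<Inter>u. {l :: 'i \<Rightarrow> real.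
        \<bar>\<Sum>i\<in>F. l i * u i\<bar> \<le> (\<Sum>i\<in>F. \<bar>u i\<bar> powr p) powr (1 / p)})"
      by (auto simp: dual_ball_def)
    also have "closed \<dots>"
      by (intro closed_INT ballI closed_Collect_le continuous_intros continuous_on_product_coordinates)
    finally show ?thesis .
  qed
  moreover have "dual_ball p \<subseteq> PiE UNIV (\<lambda>_. {-1..1})"
    using dual_ball_coord by (fastforce simp: abs_le_iff)
  ultimately show ?thesis
    by (metis compact_cube compact_Int_closed inf.absorb_iff2)
qed

text \<open>Pair \<open>l\<close> with the numbers \<open>\<plusminus>\<parallel>x\<^sub>i\<parallel>\<close>, the signs being those of the \<open>l\<^sub>i\<close>.\<close>

lemma dual_ball_sum_norm_le:
  fixes x :: "'i \<Rightarrow> 'a::real_normed_vector"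
  assumes p: "1 \<le> p" and l: "l \<in> dual_ball p" and F: "finite F"
  shows "(\<Sum>i\<in>F. norm (l i *\<^sub>R x i)) \<le> (\<Sum>i\<in>F. norm (x i) powr p) powr (1 / p)"
proof -
  define u where "u i = sgn (l i) * norm (x i)" for i
  have "(\<Sum>i\<in>F. norm (l i *\<^sub>R x i)) = (\<Sum>i\<in>F. l i * u i)"
    by (intro sum.cong) (auto simp: u_def sgn_if)
  also have "\<dots> \<le> (\<Sum>i\<in>F. \<bar>u i\<bar> powr p) powr (1 / p)"
    using dual_ballD[OF l F, of u] by simp
  also have "\<dots> \<le> (\<Sum>i\<in>F. norm (x i) powr p) powr (1 / p)"
    using p by (intro powr_mono2 sum_mono) (auto simp: u_def abs_mult sgn_if sum_nonneg)
  finally show ?thesis .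
qed

lemma dual_ball_abs_summable:
  fixes x :: "'i \<Rightarrow> 'a::real_normed_vector"
  assumes p: "1 \<le> p" and l: "l \<in> dual_ball p"
    and x: "(\<lambda>i. norm (x i) powr p) summable_on UNIV"
  shows "(\<lambda>i. l i *\<^sub>R x i) abs_summable_on UNIV"
proof (rule nonneg_bdd_above_summable_on)
  show "bdd_above (sum (\<lambda>i. norm (l i *\<^sub>R x i)) ` {F. F \<subseteq> UNIV \<and> finite F})"
  proof (rule bdd_aboveI2)
    fix F :: "'i set" assume F: "F \<in> {F. F \<subseteq> UNIV \<and> finite F}"
    then have "(\<Sum>i\<in>F. norm (l i *\<^sub>R x i)) \<le> (\<Sum>i\<in>F. norm (x i) powr p) powr (1 / p)"
      using p l by (intro dual_ball_sum_norm_le) auto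
    also have "\<dots> \<le> (\<Sum>\<^sub>\<infinity>i. norm (x i) powr p) powr (1 / p)"
      using x p F by (intro powr_mono2 finite_sum_le_infsum sum_nonneg) auto
    finally show "(\<Sum>i\<in>F. norm (l i *\<^sub>R x i)) \<le> (\<Sum>\<^sub>\<infinity>i. norm (x i) powr p) powr (1 / p)" .
  qed
qed auto

lemma dual_ball_summable:
  fixes x :: "nat \<Rightarrow> 'a::banach"
  assumes p: "1 \<le> p" and l: "l \<in> dual_ball p" and x: "norm_p_summable p x"
  shows "summable (\<lambda>i. l i *\<^sub>R x i)"
    and "norm (\<Sum>i. l i *\<^sub>R x i) \<le> (\<Sum>i. norm (x i) powr p) powr (1 / p)"
proof -
  have x: "summable (\<lambda>i. norm (x i) powr p)" using x by (simp add: norm_p_summable_def)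
  have bound: "(\<Sum>i<n. norm (l i *\<^sub>R x i)) \<le> (\<Sum>i. norm (x i) powr p) powr (1 / p)" for n
  proof -
    have "(\<Sum>i<n. norm (l i *\<^sub>R x i)) \<le> (\<Sum>i<n. norm (x i) powr p) powr (1 / p)"
      using p l by (intro dual_ball_sum_norm_le) auto
    also have "\<dots> \<le> (\<Sum>i. norm (x i) powr p) powr (1 / p)"
      using x p by (intro powr_mono2 sum_le_suminf sum_nonneg) auto
    finally show ?thesis .
  qed
  have s: "summable (\<lambda>i. norm (l i *\<^sub>R x i))"
  proof (rule summableI_nonneg_bounded)
    show "0 \<le> norm (l i *\<^sub>R x i)" for i by simp
    show "(\<Sum>i<n. norm (l i *\<^sub>R x i)) \<le> (\<Sum>i. norm (x i) powr p) powr (1 / p)" for n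
      by (rule bound)
  qed
  then show "summable (\<lambda>i. l i *\<^sub>R x i)" by (rule summable_norm_cancel)
  show "norm (\<Sum>i. l i *\<^sub>R x i) \<le> (\<Sum>i. norm (x i) powr p) powr (1 / p)"
    using summable_norm[OF s] suminf_le_const[OF s bound] by linarith
qed

text \<open>The tails of \<open>\<Sum>l\<^sub>i x\<^sub>i\<close> are bounded by the tails of \<open>\<Sum>\<parallel>x\<^sub>i\<parallel>\<^sup>p\<close>, uniformly in \<open>l\<close>, so the sum is
  continuous in \<open>l\<close> for the product topology. This makes relatively \<open>p\<close>-compact sets relatively
  compact.\<close>

lemma compact_dual_ball_sums:
  fixes x :: "nat \<Rightarrow> 'a::banach"
  assumes p: "1 \<le> p" and x: "norm_p_summable p x"
  shows "compact ((\<lambda>l. \<Sum>i. l i *\<^sub>R x i) ` dual_ball p)"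
proof (rule compact_continuous_image[OF _ compact_dual_ball])
  define r where "r n = (\<Sum>i. norm (x (i + n)) powr p) powr (1 / p)" for n
  have sx: "summable (\<lambda>i. norm (x i) powr p)" using x by (simp add: norm_p_summable_def)
  have "(\<lambda>n. \<Sum>i. norm (x (i + n)) powr p) \<longlonglongrightarrow> 0"
    using sx by (rule suminf_exist_split2)
  then have "r \<longlonglongrightarrow> 0 powr (1 / p)"
    unfolding r_def using p
    by (intro tendsto_powr2 tendsto_const) (auto intro!: always_eventually suminf_nonneg summable_ignore_initial_segment sx)
  then have r: "r \<longlonglongrightarrow> 0" by simp
  have le: "norm ((\<Sum>i<n. l i *\<^sub>R x i) - (\<Sum>i. l i *\<^sub>R x i)) \<le> r n" if l: "l \<in> dual_ball p" for l n
  proof -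
    have "(\<Sum>i. l i *\<^sub>R x i) = (\<Sum>i. l (i + n) *\<^sub>R x (i + n)) + (\<Sum>i<n. l i *\<^sub>R x i)"
      using dual_ball_summable(1)[OF p l x] by (rule suminf_split_initial_segment)
    moreover have "norm (\<Sum>i. l (i + n) *\<^sub>R x (i + n)) \<le> r n"
      unfolding r_def
    proof (rule dual_ball_summable(2)[OF p])
      show "(\<lambda>i. l (i + n)) \<in> dual_ball p"
        using dual_ball_reindex[OF _ l, of "\<lambda>i. i + n"] by (simp add: o_def inj_on_def)
      show "norm_p_summable p (\<lambda>i. x (i + n))"
        unfolding norm_p_summable_def by (rule summable_ignore_initial_segment[OF sx])
    qed
    ultimately show ?thesis by simp
  qed
  have "uniform_limit (dual_ball p) (\<lambda>n l. \<Sum>i<n. l i *\<^sub>R x i) (\<lambda>l. \<Sum>i. l i *\<^sub>R x i) sequentially"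
  proof (rule uniform_limitI)
    fix e :: real assume "e > 0"
    then have "eventually (\<lambda>n. r n < e) sequentially"
      using r by (intro order_tendstoD)
    then show "\<forall>\<^sub>F n in sequentially. \<forall>l\<in>dual_ball p.
        dist (\<Sum>i<n. l i *\<^sub>R x i) (\<Sum>i. l i *\<^sub>R x i) < e"
      by eventually_elim (use le in \<open>fastforce simp: dist_norm intro: le_less_trans\<close>)
  qed
  then show "continuous_on (dual_ball p) (\<lambda>l. \<Sum>i. l i *\<^sub>R x i)"
    by (rule uniform_limit_theorem[rotated])
       (auto intro!: always_eventually continuous_intros continuous_on_subset[OF continuous_on_product_coordinates])
qed

section \<open>Minimax by approachability\<close>

text \<open>A finite minimax theorem in the style of Blackwell. If every mixture of the payoffs \<open>v j\<close> admits a
  response \<open>y\<close> with nonnegative value, then some finite sequence of responses has all average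
  payoffs nonnegative up to \<open>e\<close>. At each step the mixture weighs the payoffs by their current
  deficits. The response then has a favourable inner product with the deficit vector, so the squared
  length of that vector grows at most linearly in time, and the average deficit tends to \<open>0\<close>.\<close>

lemma approachability:
  fixes v :: "'j \<Rightarrow> 'y \<Rightarrow> real"
  assumes J: "finite J"
    and bound: "\<And>j y. j \<in> J \<Longrightarrow> y \<in> D \<Longrightarrow> \<bar>v j y\<bar> \<le> M"
    and response: "\<And>t. (\<And>j. 0 \<le> t j) \<Longrightarrow> \<exists>y\<in>D. 0 \<le> (\<Sum>j\<in>J. t j * v j y)"
    and e: "0 < e"
  obtains T :: nat and y where "T > 0" "\<And>i. i < T \<Longrightarrow> y i \<in> D"
    "\<And>j. j \<in> J \<Longrightarrow> - e \<le> (\<Sum>i<T. v j (y i)) / real T"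
proof -
  define R where "R t = (SOME y. y \<in> D \<and> 0 \<le> (\<Sum>j\<in>J. t j * v j y))" for t
  have R: "R t \<in> D" "0 \<le> (\<Sum>j\<in>J. t j * v j (R t))" if "\<And>j. 0 \<le> t j" for t
    using someI_ex[of "\<lambda>y. y \<in> D \<and> 0 \<le> (\<Sum>j\<in>J. t j * v j y)"] response[of t] that
    unfolding R_def by auto
  define neg where "neg s j = max 0 (- s j)" for s :: "'j \<Rightarrow> real" and j
  define s where "s = rec_nat (\<lambda>_. 0) (\<lambda>_ s j. s j + v j (R (neg s)))"
  define y where "y n = R (neg (s n))" for n
  have s_Suc: "s (Suc n) j = s n j + v j (y n)" for n j
    by (simp add: s_def y_def)
  have s_sum: "s n j = (\<Sum>i<n. v j (y i))" for n j
    by (induction n) (simp_all add: s_Suc, simp add: s_def)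
  have y: "y n \<in> D" "0 \<le> (\<Sum>j\<in>J. neg (s n) j * v j (y n))" for n
    unfolding y_def by (rule R, simp add: neg_def)+
  have potential: "(\<Sum>j\<in>J. (neg (s n) j)\<^sup>2) \<le> real n * (real (card J) * M\<^sup>2)" for n
  proof (induction n)
    case 0
    then show ?case by (simp add: neg_def s_def)
  next
    case (Suc n)
    have "(neg (s (Suc n)) j)\<^sup>2 \<le> (neg (s n) j)\<^sup>2 - 2 * (neg (s n) j * v j (y n)) + M\<^sup>2" if j: "j \<in> J" for j
    proof -
      have "(neg (s (Suc n)) j)\<^sup>2 \<le> (neg (s n) j - v j (y n))\<^sup>2"
        unfolding abs_le_square_iff[symmetric] by (simp add: neg_def s_Suc max_def abs_if)
      moreover have "(v j (y n))\<^sup>2 \<le> M\<^sup>2"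
        using bound[OF j y(1)[of n]] by (simp add: abs_le_square_iff[symmetric])
      ultimately show ?thesis by (simp add: power2_diff)
    qed
    then have "(\<Sum>j\<in>J. (neg (s (Suc n)) j)\<^sup>2)
        \<le> (\<Sum>j\<in>J. (neg (s n) j)\<^sup>2 - 2 * (neg (s n) j * v j (y n)) + M\<^sup>2)"
      by (rule sum_mono)
    also have "\<dots> = (\<Sum>j\<in>J. (neg (s n) j)\<^sup>2) - 2 * (\<Sum>j\<in>J. neg (s n) j * v j (y n)) + real (card J) * M\<^sup>2"
      by (simp add: sum.distrib sum_subtractf sum_distrib_left)
    also have "\<dots> \<le> real n * (real (card J) * M\<^sup>2) + real (card J) * M\<^sup>2"
      using Suc y(2)[of n] by linarith
    finally show ?case by (simp add: algebra_simps)
  qed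
  obtain T where T: "real (card J) * M\<^sup>2 / e\<^sup>2 < real T"
    using reals_Archimedean2 by blast
  have T0: "T > 0"
  proof -
    have "0 \<le> real (card J) * M\<^sup>2 / e\<^sup>2" by simp
    with T have "0 < real T" by linarith
    then show ?thesis by simp
  qed
  have "- e \<le> (\<Sum>i<T. v j (y i)) / real T" if j: "j \<in> J" for j
  proof -
    have "(neg (s T) j)\<^sup>2 \<le> (\<Sum>j\<in>J. (neg (s T) j)\<^sup>2)"
      using j J by (intro member_le_sum) auto
    also have "\<dots> \<le> real T * (real (card J) * M\<^sup>2)" by (rule potential)
    also have "\<dots> \<le> real T * (real T * e\<^sup>2)"
      using T e by (intro mult_left_mono) (auto simp: field_simps)
    also have "\<dots> = (real T * e)\<^sup>2" by (simp add: power2_eq_square)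
    finally have "neg (s T) j \<le> real T * e"
      by (rule power2_le_imp_le) (use e in simp)
    then have "- (real T * e) \<le> s T j" by (simp add: neg_def)
    then show ?thesis using T0 by (simp add: s_sum field_simps)
  qed
  with T0 y(1) show ?thesis using that by blast
qed

text \<open>The bipolar theorem in finite dimensions. The vector \<open>\<xi>\<close> is dominated by the support function of
  the compact convex set of all \<open>\<Sum>l\<^sub>i \<zeta>\<^sub>i\<close>, so it belongs to that set. Approachability, applied to the
  payoffs \<open>\<plusminus>(\<Sum>l\<^sub>i \<zeta>\<^sub>i a - \<xi> a)\<close>, reaches \<open>\<xi>\<close> up to \<open>e\<close>, since averages stay in the dual ball;
  compactness removes the error.\<close>

lemma dual_ball_interpolation:
  fixes \<xi> :: "'b \<Rightarrow> real" and \<zeta> :: "nat \<Rightarrow> 'b \<Rightarrow> real"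
  assumes p: "1 \<le> p" and J: "finite J"
    and dom: "\<And>r. \<bar>\<Sum>a\<in>J. r a * \<xi> a\<bar> powr p \<le> (\<Sum>i<n. \<bar>\<Sum>a\<in>J. r a * \<zeta> i a\<bar> powr p)"
  obtains l where "l \<in> dual_ball p" "\<And>a. a \<in> J \<Longrightarrow> \<xi> a = (\<Sum>i<n. l i * \<zeta> i a)"
proof -
  define D where "D = (dual_ball p :: (nat \<Rightarrow> real) set)"
  define v where "v = (\<lambda>(a, s) l. (if s then 1 else -1) * ((\<Sum>i<n. l i * \<zeta> i a) - \<xi> a))"
  define M where "M = (\<Sum>a\<in>J. (\<Sum>i<n. \<bar>\<zeta> i a\<bar>) + \<bar>\<xi> a\<bar>)"
  have bound: "\<bar>v j l\<bar> \<le> M" if jl: "j \<in> J \<times> UNIV" "l \<in> D" for j l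
  proof -
    obtain a s where j: "j = (a, s)" "a \<in> J" using jl(1) by auto
    have "\<bar>(\<Sum>i<n. l i * \<zeta> i a)\<bar> \<le> (\<Sum>i<n. \<bar>l i * \<zeta> i a\<bar>)" by (rule sum_abs)
    also have "\<dots> \<le> (\<Sum>i<n. \<bar>\<zeta> i a\<bar>)"
      using dual_ball_coord[OF jl(2)[unfolded D_def]]
      by (intro sum_mono) (simp add: abs_mult mult_left_le_one_le)
    finally have "\<bar>v j l\<bar> \<le> (\<Sum>i<n. \<bar>\<zeta> i a\<bar>) + \<bar>\<xi> a\<bar>"
      unfolding j(1) v_def by (auto simp: abs_if split: if_splits)
    also have "\<dots> \<le> M"
      unfolding M_def using J j
      by (intro member_le_sum[where f = "\<lambda>a. (\<Sum>i<n. \<bar>\<zeta> i a\<bar>) + \<bar>\<xi> a\<bar>"]) (auto intro!: sum_nonneg add_nonneg_nonneg)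
    finally show ?thesis .
  qed
  have response: "\<exists>l\<in>D. 0 \<le> (\<Sum>j\<in>J \<times> UNIV. t j * v j l)" for t :: "'b \<times> bool \<Rightarrow> real"
  proof -
    define r where "r a = t (a, True) - t (a, False)" for a
    obtain l where l: "l \<in> D"
      "(\<Sum>i<n. l i * (\<Sum>a\<in>J. r a * \<zeta> i a)) = (\<Sum>i<n. \<bar>\<Sum>a\<in>J. r a * \<zeta> i a\<bar> powr p) powr (1 / p)"
      using dual_ball_norming[OF p, of "{..<n}" "\<lambda>i. \<Sum>a\<in>J. r a * \<zeta> i a"] unfolding D_def by blast
    have "(\<bar>\<Sum>a\<in>J. r a * \<xi> a\<bar> powr p) powr (1 / p)
        \<le> (\<Sum>i<n. \<bar>\<Sum>a\<in>J. r a * \<zeta> i a\<bar> powr p) powr (1 / p)"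
      using p by (intro powr_mono2 dom) auto
    then have "(\<Sum>a\<in>J. r a * \<xi> a) \<le> (\<Sum>i<n. l i * (\<Sum>a\<in>J. r a * \<zeta> i a))"
      using p l(2) by (simp add: powr_powr)
    also have "\<dots> = (\<Sum>i<n. \<Sum>a\<in>J. r a * (l i * \<zeta> i a))"
      by (simp add: sum_distrib_left mult_ac)
    also have "\<dots> = (\<Sum>a\<in>J. r a * (\<Sum>i<n. l i * \<zeta> i a))"
      by (subst sum.swap) (simp add: sum_distrib_left)
    finally have "0 \<le> (\<Sum>a\<in>J. r a * ((\<Sum>i<n. l i * \<zeta> i a) - \<xi> a))"
      by (simp add: right_diff_distrib sum_subtractf)
    also have "\<dots> = (\<Sum>a\<in>J. \<Sum>s\<in>UNIV. t (a, s) * v (a, s) l)"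
      by (intro sum.cong) (auto simp: r_def v_def UNIV_bool algebra_simps)
    also have "\<dots> = (\<Sum>j\<in>J \<times> UNIV. t j * v j l)"
      by (simp add: sum.cartesian_product case_prod_unfold)
    finally show ?thesis using l(1) by blast
  qed
  have approx: "\<exists>l\<in>D. \<forall>a\<in>J. \<bar>(\<Sum>i<n. l i * \<zeta> i a) - \<xi> a\<bar> \<le> e" if e: "e > 0" for e
  proof -
    obtain T y where T: "T > 0" "\<And>k. k < T \<Longrightarrow> y k \<in> D"
      "\<And>j. j \<in> J \<times> UNIV \<Longrightarrow> - e \<le> (\<Sum>k<T. v j (y k)) / real T"
      by (rule approachability[of "J \<times> (UNIV :: bool set)" D v M e])
         (use J bound response e in auto)
    define l where "l = (\<lambda>i. (\<Sum>k<T. y k i) / real T)"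
    have "l \<in> D" using dual_ball_average[of T y p] T by (simp add: l_def D_def)
    moreover have "\<bar>(\<Sum>i<n. l i * \<zeta> i a) - \<xi> a\<bar> \<le> e" if a: "a \<in> J" for a
    proof -
      have "(\<Sum>k<T. v (a, s) (y k)) / real T = v (a, s) l" for s
      proof -
        have "(\<Sum>i<n. l i * \<zeta> i a) = (\<Sum>i<n. \<Sum>k<T. y k i * \<zeta> i a) / real T"
          by (simp add: l_def sum_divide_distrib sum_distrib_right)
        also have "(\<Sum>i<n. \<Sum>k<T. y k i * \<zeta> i a) = (\<Sum>k<T. \<Sum>i<n. y k i * \<zeta> i a)"
          by (rule sum.swap)
        finally show ?thesis
          using T(1) by (simp add: v_def sum_subtractf sum_negf diff_divide_distrib)
      qed
      then have "- e \<le> v (a, True) l" "- e \<le> v (a, False) l"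
        using T(3)[of "(a, True)"] T(3)[of "(a, False)"] a by auto
      then show ?thesis by (simp add: v_def abs_if)
    qed
    ultimately show ?thesis by blast
  qed
  define h where "h l = (\<Sum>a\<in>J. \<bar>(\<Sum>i<n. l i * \<zeta> i a) - \<xi> a\<bar>)" for l
  have "D \<noteq> {}" using approx[of 1] by auto
  moreover have "continuous_on D h"
    unfolding h_def by (intro continuous_intros continuous_on_subset[OF continuous_on_product_coordinates]) auto
  ultimately obtain l where l: "l \<in> D" "\<And>l'. l' \<in> D \<Longrightarrow> h l \<le> h l'"
    using continuous_attains_inf[of D h] compact_dual_ball unfolding D_def by metis
  have "h l \<le> 0"
  proof (rule field_le_epsilon)
    fix e :: real assume e: "e > 0"
    then have "e / (real (card J) + 1) > 0" by simp
    from approx[OF this] obtain l' where l': "l' \<in> D"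
      "\<forall>a\<in>J. \<bar>(\<Sum>i<n. l' i * \<zeta> i a) - \<xi> a\<bar> \<le> e / (real (card J) + 1)" by blast
    have "h l' \<le> (\<Sum>a\<in>J. e / (real (card J) + 1))"
      unfolding h_def using l' by (intro sum_mono) auto
    also have "\<dots> \<le> e" using e by (simp add: field_simps)
    finally show "h l \<le> 0 + e" using l(2)[OF l'(1)] by simp
  qed
  then have "\<forall>a\<in>J. \<bar>(\<Sum>i<n. l i * \<zeta> i a) - \<xi> a\<bar> = 0"
    unfolding h_def using J by (subst sum_nonneg_eq_0_iff[symmetric]) (auto intro!: antisym sum_nonneg)
  with l(1) show ?thesis using that by (auto simp: D_def)
qed

section \<open>Convex combinations of pointwise null sequences\<close>

text \<open>Dyadic convex combinations of the functions \<open>\<phi> k\<close> with \<open>k \<ge> n\<close>. Midpoints alone suffice below, and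
  closure under them gives induction over the hull.\<close>

inductive_set midpoint_hull :: "(nat \<Rightarrow> 'b \<Rightarrow> real) \<Rightarrow> nat \<Rightarrow> ('b \<Rightarrow> real) set"
  for \<phi> :: "nat \<Rightarrow> 'b \<Rightarrow> real" and n :: nat where
  generator: "n \<le> k \<Longrightarrow> \<phi> k \<in> midpoint_hull \<phi> n"
| midpoint: "g \<in> midpoint_hull \<phi> n \<Longrightarrow> g' \<in> midpoint_hull \<phi> n
    \<Longrightarrow> (\<lambda>y. (g y + g' y) / 2) \<in> midpoint_hull \<phi> n"

lemma midpoint_hull_mono: "g \<in> midpoint_hull \<phi> n \<Longrightarrow> m \<le> n \<Longrightarrow> g \<in> midpoint_hull \<phi> m"
  by (induction rule: midpoint_hull.induct) (auto intro: midpoint_hull.intros)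

lemma midpoint_hull_upper:
  "g \<in> midpoint_hull \<phi> n \<Longrightarrow> (\<And>k. n \<le> k \<Longrightarrow> \<phi> k y \<le> d) \<Longrightarrow> g y \<le> d"
  by (induction rule: midpoint_hull.induct) (auto simp: field_simps intro: add_mono)

lemma midpoint_hull_lower:
  "g \<in> midpoint_hull \<phi> n \<Longrightarrow> (\<And>k. n \<le> k \<Longrightarrow> d \<le> \<phi> k y) \<Longrightarrow> d \<le> g y"
  by (induction rule: midpoint_hull.induct) (auto simp: field_simps intro: add_mono)

lemma midpoint_hull_continuous:
  "g \<in> midpoint_hull \<phi> n \<Longrightarrow> (\<And>k. continuous_on K (\<phi> k)) \<Longrightarrow> continuous_on K g"
  by (induction rule: midpoint_hull.induct) (auto intro!: continuous_intros)

lemma midpoint_hull_convex_combination: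
  assumes "g \<in> midpoint_hull \<phi> n"
  shows "\<exists>N t. (\<forall>k. 0 \<le> t k) \<and> (\<forall>k\<ge>N. t k = 0) \<and> (\<Sum>k<N. t k) = (1::real)
    \<and> (\<forall>y. g y = (\<Sum>k<N. t k * \<phi> k y))"
  using assms
proof (induction rule: midpoint_hull.induct)
  case (generator k)
  have "(\<Sum>i<Suc k. of_bool (i = k) * \<phi> i y) = \<phi> k y" for y
    by (simp add: if_distrib of_bool_def cong: if_cong)
  then show ?case
    by (intro exI[of _ "Suc k"] exI[of _ "\<lambda>i. of_bool (i = k)"]) auto
next
  case (midpoint g g')
  obtain N t where t: "\<And>k. 0 \<le> t k" "\<And>k. k \<ge> N \<Longrightarrow> t k = 0" "(\<Sum>k<N. t k) = 1"
    "\<And>y. g y = (\<Sum>k<N. t k * \<phi> k y)" using midpoint.IH(1) by blast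
  obtain N' t' where t': "\<And>k. 0 \<le> t' k" "\<And>k. k \<ge> N' \<Longrightarrow> t' k = 0" "(\<Sum>k<N'. t' k) = 1"
    "\<And>y. g' y = (\<Sum>k<N'. t' k * \<phi> k y)" using midpoint.IH(2) by blast
  define n where "n = max N N'"
  have ext: "(\<Sum>k<n. t k * f k) = (\<Sum>k<N. t k * f k)" "(\<Sum>k<n. t' k * f k) = (\<Sum>k<N'. t' k * f k)" for f
    by (rule sum.mono_neutral_right; auto simp: n_def t t')+
  show ?case
  proof (intro exI[of _ n] exI[of _ "\<lambda>k. (t k + t' k) / 2"] conjI allI impI)
    show "(\<Sum>k<n. (t k + t' k) / 2) = 1"
      using ext[of "\<lambda>_. 1"] t t' by (simp add: sum.distrib flip: sum_divide_distrib)
    show "(g y + g' y) / 2 = (\<Sum>k<n. (t k + t' k) / 2 * \<phi> k y)" for y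
      using ext[of "\<lambda>k. \<phi> k y"] t t'
      by (simp add: sum.distrib algebra_simps flip: sum_divide_distrib)
  qed (use t t' in \<open>auto simp: n_def\<close>)
qed

text \<open>Simons' inequality for a pointwise null sequence. Suppose that \<open>sup g > c\<close> for all \<open>g\<close> in the
  hull. Choose \<open>g n\<close> in the hull of the \<open>\<phi> k\<close> with \<open>k \<ge> n\<close> so that it almost minimizes
  \<open>sup (h n + g / 2\<^sup>n)\<close>, where \<open>h n = \<Sum>k<n. g k / 2\<^sup>k\<^sup>+\<^sup>1\<close>, and let \<open>H\<close> be the limit of the \<open>h n\<close>. The
  remainder of the series from index \<open>n\<close> on is \<open>2\<^sup>-\<^sup>n\<close> times a convex combination, so the minimal
  value at stage \<open>n\<close> is at most about \<open>sup H\<close>. Convexity of the supremum then bounds \<open>sup (h n)\<close> by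
  about \<open>(1 - 2\<^sup>-\<^sup>n) sup H\<close>. At a point \<open>y\<close> where \<open>H\<close> attains its supremum, which exists by compactness,
  the average of the \<open>g k y\<close> with \<open>k \<ge> n\<close> is therefore at least about \<open>sup H \<ge> c\<close> for every \<open>n\<close>.
  This is impossible, since \<open>\<phi> k y\<close> tends to \<open>0\<close>.\<close>

lemma null_sequence_midpoint_hull:
  fixes \<phi> :: "nat \<Rightarrow> 'b::topological_space \<Rightarrow> real"
  assumes K: "compact K" "K \<noteq> {}"
    and cont: "\<And>k. continuous_on K (\<phi> k)"
    and range: "\<And>k y. y \<in> K \<Longrightarrow> 0 \<le> \<phi> k y" "\<And>k y. y \<in> K \<Longrightarrow> \<phi> k y \<le> 1"
    and null: "\<And>y. y \<in> K \<Longrightarrow> (\<lambda>k. \<phi> k y) \<longlonglongrightarrow> 0"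
    and c: "c > 0"
  shows "\<exists>g\<in>midpoint_hull \<phi> 0. \<forall>y\<in>K. g y \<le> c"
proof (rule ccontr)
  assume contra: "\<not> ?thesis"
  define C where "C n = midpoint_hull \<phi> n" for n
  have C_range: "0 \<le> g y" "g y \<le> 1" if "g \<in> C n" "y \<in> K" for g n y
    using that range by (auto simp: C_def intro: midpoint_hull_lower midpoint_hull_upper)
  define \<epsilon> where "\<epsilon> = c / 6"
  have \<epsilon>: "\<epsilon> > 0" using c by (simp add: \<epsilon>_def)
  define S where "S g = (SUP y\<in>K. g y)" for g :: "'b \<Rightarrow> real"
  have S_least: "S g \<le> b" if "\<And>y. y \<in> K \<Longrightarrow> g y \<le> b" for g b
    unfolding S_def using K(2) that by (rule cSUP_least)
  have S_upper: "g y \<le> S g" if "y \<in> K" "\<And>z. z \<in> K \<Longrightarrow> g z \<le> b" for g y b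
    unfolding S_def using that by (intro cSUP_upper bdd_aboveI2[where M=b])
  have near: "\<exists>g\<in>C n. \<forall>g'\<in>C n. S (\<lambda>y. h y + g y / 2 ^ n) \<le> S (\<lambda>y. h y + g' y / 2 ^ n) + \<epsilon> / 4 ^ n"
    if h: "\<And>y. y \<in> K \<Longrightarrow> 0 \<le> h y" "\<And>y. y \<in> K \<Longrightarrow> h y \<le> 1" for h n
  proof -
    define W where "W = (\<lambda>g. S (\<lambda>y. h y + g y / 2 ^ n)) ` C n"
    have "C n \<noteq> {}" using midpoint_hull.generator[of n n \<phi>] by (auto simp: C_def)
    then have W: "W \<noteq> {}" by (simp add: W_def)
    have bdd: "bdd_below W"
    proof (rule bdd_belowI[where m=0])
      fix w assume "w \<in> W"
      then obtain g where g: "g \<in> C n" "w = S (\<lambda>y. h y + g y / 2 ^ n)" by (auto simp: W_def)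
      obtain y where y: "y \<in> K" using K by auto
      have "h z + g z / 2 ^ n \<le> 1 + 1" if "z \<in> K" for z
        using h(2)[OF that] C_range[OF g(1) that]
        by (intro add_mono) (auto simp: divide_le_eq order_trans[OF _ one_le_power])
      from S_upper[where g = "\<lambda>y. h y + g y / 2 ^ n", OF y this]
      show "0 \<le> w" using h(1)[OF y] C_range(1)[OF g(1) y] unfolding g(2)
        by (meson add_nonneg_nonneg divide_nonneg_nonneg order_trans zero_le_numeral zero_le_power)
    qed
    have "Inf W < Inf W + \<epsilon> / 4 ^ n" using \<epsilon> by simp
    then obtain w where w: "w \<in> W" "w < Inf W + \<epsilon> / 4 ^ n"
      using cInf_lessD[OF W] by blast
    then obtain g where g: "g \<in> C n" "w = S (\<lambda>y. h y + g y / 2 ^ n)" by (auto simp: W_def)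
    have "w \<le> S (\<lambda>y. h y + g' y / 2 ^ n) + \<epsilon> / 4 ^ n" if "g' \<in> C n" for g'
    proof -
      have "Inf W \<le> S (\<lambda>y. h y + g' y / 2 ^ n)"
        using that bdd by (intro cInf_lower) (auto simp: W_def)
      then show ?thesis using w by linarith
    qed
    with g show ?thesis by blast
  qed
  define G where "G n h = (SOME g. g \<in> C n \<and>
    (\<forall>g'\<in>C n. S (\<lambda>y. h y + g y / 2 ^ n) \<le> S (\<lambda>y. h y + g' y / 2 ^ n) + \<epsilon> / 4 ^ n))" for n h
  define h where "h = rec_nat (\<lambda>_. 0) (\<lambda>n h y. h y + G n h y / 2 ^ Suc n)"
  define g where "g n = G n (h n)" for n
  have h_0: "h 0 = (\<lambda>_. 0)" by (simp add: h_def)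
  have h_Suc: "h (Suc n) y = h n y + g n y / 2 ^ Suc n" for n y by (simp add: h_def g_def)
  have main: "(\<forall>y\<in>K. 0 \<le> h n y \<and> h n y \<le> 1 - 1 / 2 ^ n) \<and> g n \<in> C n \<and>
    (\<forall>g'\<in>C n. S (\<lambda>y. h n y + g n y / 2 ^ n) \<le> S (\<lambda>y. h n y + g' y / 2 ^ n) + \<epsilon> / 4 ^ n)" for n
  proof (induction n)
    have step: "g n \<in> C n \<and>
      (\<forall>g'\<in>C n. S (\<lambda>y. h n y + g n y / 2 ^ n) \<le> S (\<lambda>y. h n y + g' y / 2 ^ n) + \<epsilon> / 4 ^ n)"
      if "\<forall>y\<in>K. 0 \<le> h n y \<and> h n y \<le> 1 - 1 / 2 ^ n" for n
    proof -
      have "h n y \<le> 1" if "y \<in> K" for y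
        using that \<open>\<forall>y\<in>K. _\<close> by (smt (verit) zero_le_divide_1_iff zero_le_power)
      then show ?thesis
        using someI_ex[OF near[of "h n" n, unfolded Bex_def]] that unfolding g_def G_def by blast
    qed
    {
      case 0
      show ?case using step[of 0] by (simp add: h_0)
    next
      case (Suc n)
      have half: "1 / 2 ^ n = 2 * (1 / 2 ^ Suc n :: real)" for n by simp
      have "\<forall>y\<in>K. 0 \<le> h (Suc n) y \<and> h (Suc n) y \<le> 1 - 1 / 2 ^ Suc n"
      proof
        fix y assume y: "y \<in> K"
        have "0 \<le> g n y" "g n y \<le> 1" using Suc C_range y by blast+
        moreover from this have "0 \<le> g n y / 2 ^ Suc n" "g n y / 2 ^ Suc n \<le> 1 / 2 ^ Suc n"
          by (simp, intro divide_right_mono) auto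
        moreover have "0 \<le> h n y" "h n y \<le> 1 - 1 / 2 ^ n" using Suc y by auto
        ultimately show "0 \<le> h (Suc n) y \<and> h (Suc n) y \<le> 1 - 1 / 2 ^ Suc n"
          unfolding h_Suc using half[of n] by linarith
      qed
      with step[of "Suc n"] show ?case by blast
    }
  qed
  have g: "g n \<in> C n" for n using main by blast
  have g_range: "0 \<le> g n y" "g n y \<le> 1" if "y \<in> K" for n y using C_range g that by blast+
  have h_range: "0 \<le> h n y" "h n y \<le> 1" if "y \<in> K" for n y
    using main[of n] that by (auto, smt (verit) zero_le_divide_1_iff zero_le_power)
  define A where "A n = S (\<lambda>y. h n y + g n y / 2 ^ n)" for n
  have A_min: "A n \<le> S (\<lambda>y. h n y + g' y / 2 ^ n) + \<epsilon> / 4 ^ n" if "g' \<in> C n" for g' n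
    using main that by (auto simp: A_def)
  have h_sum: "h n y = (\<Sum>k<n. g k y / 2 ^ Suc k)" for n y
    by (induction n) (simp_all add: h_0 h_Suc)
  define H where "H y = (\<Sum>k. g k y / 2 ^ Suc k)" for y
  have geo: "(\<lambda>k. 1 / 2 ^ Suc k :: real) sums 1"
    using power_half_series by (simp add: power_divide)
  have term_le: "norm (g k y / 2 ^ Suc k) \<le> 1 / 2 ^ Suc k" if "y \<in> K" for k y
    using g_range[OF that] by (simp add: divide_right_mono)
  have H_unif: "uniform_limit K h H sequentially"
    unfolding H_def h_sum[abs_def] using geo term_le
    by (intro Weierstrass_m_test[where M = "\<lambda>k. 1 / 2 ^ Suc k"]) (auto dest: sums_summable)
  have H_summable: "summable (\<lambda>k. g k y / 2 ^ Suc k)" if "y \<in> K" for y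
    using term_le[OF that] sums_summable[OF geo] by (rule summable_comparison_test'[rotated])
  have h_cont: "continuous_on K (h n)" for n
    unfolding h_sum[abs_def] using g cont
    by (intro continuous_intros) (auto simp: C_def intro: midpoint_hull_continuous)
  have H_cont: "continuous_on K H"
    by (rule uniform_limit_theorem[OF _ H_unif]) (auto intro: always_eventually h_cont)
  obtain y where y: "y \<in> K" "\<And>z. z \<in> K \<Longrightarrow> H z \<le> H y"
    using continuous_attains_sup[OF K H_cont] by blast
  have h_le_H: "h n z \<le> H z" if "z \<in> K" for n z
    unfolding h_sum H_def using that g_range by (intro sum_le_suminf H_summable) auto
  have S_H: "S H = H y" using y S_upper[of y H "H y"] S_least[of H "H y"] by fastforce
  have A_le: "A n \<le> H y + \<epsilon> / 4 ^ n" for n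
  proof -
    \<comment> \<open>The function of stage \<open>m\<close> is a competitor at the earlier stage \<open>n\<close>.\<close>
    have rep: "\<exists>r\<in>C n. \<forall>y. h n y + r y / 2 ^ n = h m y + g m y / 2 ^ m" if "n \<le> m" for m n
      using that
    proof (induction rule: inc_induct)
      case base
      then show ?case using g by blast
    next
      case (step n)
      then obtain r where r: "r \<in> C (Suc n)" "\<And>y. h (Suc n) y + r y / 2 ^ Suc n = h m y + g m y / 2 ^ m"
        by blast
      then have "r \<in> C n" using midpoint_hull_mono[of r \<phi> "Suc n" n] by (simp add: C_def)
      then have "(\<lambda>y. (g n y + r y) / 2) \<in> C n"
        using g[of n] unfolding C_def by (intro midpoint_hull.midpoint)
      then show ?case
      proof (rule bexI[rotated], intro allI)
        show "h n y + (g n y + r y) / 2 / 2 ^ n = h m y + g m y / 2 ^ m" for y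
          using r(2)[of y] by (simp add: h_Suc field_simps)
      qed
    qed
    have "A n \<le> H y + \<epsilon> / 4 ^ n + 1 / 2 ^ m" if nm: "n \<le> m" for m
    proof -
      obtain r where r: "r \<in> C n" "\<And>y. h n y + r y / 2 ^ n = h m y + g m y / 2 ^ m"
        using rep[OF nm] by metis
      have eq: "(\<lambda>y. h n y + r y / 2 ^ n) = (\<lambda>y. h m y + g m y / 2 ^ m)"
        by (rule ext) (rule r(2))
      have "S (\<lambda>y. h n y + r y / 2 ^ n) \<le> H y + 1 / 2 ^ m"
        unfolding eq
      proof (rule S_least)
        fix z assume z: "z \<in> K"
        have "g m z / 2 ^ m \<le> 1 / 2 ^ m" using g_range[OF z] by (intro divide_right_mono) auto
        then show "h m z + g m z / 2 ^ m \<le> H y + 1 / 2 ^ m"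
          using h_le_H[OF z, of m] y(2)[OF z] by linarith
      qed
      with A_min[OF r(1)] show ?thesis by linarith
    qed
    moreover have "(\<lambda>m. H y + \<epsilon> / 4 ^ n + 1 / 2 ^ m) \<longlonglongrightarrow> H y + \<epsilon> / 4 ^ n + 0"
      by (intro tendsto_intros LIMSEQ_divide_realpow_zero) auto
    ultimately show ?thesis
      by (intro LIMSEQ_le_const[of "\<lambda>m. H y + \<epsilon> / 4 ^ n + 1 / 2 ^ m"]) auto
  qed
  \<comment> \<open>The recursion uses that \<open>h (Suc n)\<close> is the midpoint of \<open>h n\<close> and \<open>h n + g n / 2\<^sup>n\<close>.\<close>
  have S_h: "S (h n) \<le> (1 - 1 / 2 ^ n) * H y + 2 * \<epsilon> * (1 / 2 ^ n - 1 / 4 ^ n)" for n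
  proof (induction n)
    case 0
    then show ?case by (auto simp: h_0 intro: S_least)
  next
    case (Suc n)
    have "S (h (Suc n)) \<le> A n / 2 + S (h n) / 2"
    proof (rule S_least)
      fix z assume z: "z \<in> K"
      have "h n w + g n w / 2 ^ n \<le> 1 + 1" if "w \<in> K" for w
        using h_range[OF that, of n] g_range[OF that, of n]
        by (intro add_mono) (auto simp: divide_le_eq order_trans[OF _ one_le_power])
      then have "h n z + g n z / 2 ^ n \<le> A n"
        unfolding A_def using z by (intro S_upper)
      moreover have "h n z \<le> S (h n)" using z h_range by (intro S_upper)
      ultimately show "h (Suc n) z \<le> A n / 2 + S (h n) / 2" by (simp add: h_Suc)
    qed
    also have "\<dots> \<le> (H y + \<epsilon> / 4 ^ n) / 2 + ((1 - 1 / 2 ^ n) * H y + 2 * \<epsilon> * (1 / 2 ^ n - 1 / 4 ^ n)) / 2"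
      by (intro add_mono divide_right_mono A_le Suc) auto
    also have "\<dots> = (1 - 1 / 2 ^ Suc n) * H y + 2 * \<epsilon> * (1 / 2 ^ Suc n - 1 / 4 ^ Suc n)"
      by (simp add: field_simps)
    finally show ?case .
  qed
  have Hc: "c - \<epsilon> \<le> H y"
  proof -
    have "g 0 \<in> midpoint_hull \<phi> 0" using g[of 0] by (simp add: C_def)
    then obtain z where z: "z \<in> K" "c < g 0 z" using contra by (auto simp: not_le)
    then have "g 0 z \<le> A 0" unfolding A_def h_0
      using S_upper[of z "\<lambda>y. 0 + g 0 y / 2 ^ 0" 1] g_range by simp
    then show ?thesis using z A_le[of 0] by simp
  qed
  have "\<forall>\<^sub>F k in sequentially. \<phi> k y < c / 4"
    using null[OF y(1)] c by (intro order_tendstoD) auto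
  then obtain n where n: "\<And>k. n \<le> k \<Longrightarrow> \<phi> k y < c / 4"
    by (auto simp: eventually_sequentially)
  have gk: "g k y \<le> c / 4" if "n \<le> k" for k
    using g[of k] n that unfolding C_def by (intro midpoint_hull_upper[of "g k" \<phi> k]) (auto intro!: less_imp_le)
  have "H y - h n y = (\<Sum>k. g (k + n) y / 2 ^ Suc (k + n))"
    using suminf_split_initial_segment[OF H_summable[OF y(1)], of n] by (simp add: H_def h_sum)
  also have "\<dots> \<le> (\<Sum>k. (c / 4 / 2 ^ n) * (1 / 2 ^ Suc k))"
  proof (rule suminf_le)
    show "g (k + n) y / 2 ^ Suc (k + n) \<le> (c / 4 / 2 ^ n) * (1 / 2 ^ Suc k)" for k
      using gk[of "k + n"] by (simp add: field_simps power_add)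
    show "summable (\<lambda>k. g (k + n) y / 2 ^ Suc (k + n))"
      using summable_ignore_initial_segment[OF H_summable[OF y(1)]] by simp
    show "summable (\<lambda>k. (c / 4 / 2 ^ n) * (1 / 2 ^ Suc k))"
      using geo by (intro summable_mult) (rule sums_summable)
  qed
  also have "\<dots> = c / 4 / 2 ^ n"
    using geo by (subst suminf_mult) (auto simp: sums_iff)
  finally have up: "H y - h n y \<le> c / 4 / 2 ^ n" .
  have "h n y \<le> S (h n)" using y h_range by (intro S_upper)
  have "(H y - 2 * \<epsilon>) / 2 ^ n \<le> H y - h n y"
  proof -
    have "(H y - 2 * \<epsilon>) / 2 ^ n = H y - ((1 - 1 / 2 ^ n) * H y + 2 * \<epsilon> * (1 / 2 ^ n))"
      by (simp add: field_simps)
    moreover have "2 * \<epsilon> * (1 / 2 ^ n - 1 / 4 ^ n) \<le> 2 * \<epsilon> * (1 / 2 ^ n)"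
      using \<epsilon> by (intro mult_left_mono) auto
    moreover have "H y - ((1 - 1 / 2 ^ n) * H y + 2 * \<epsilon> * (1 / 2 ^ n)) \<le> H y - S (h n)"
      using S_h[of n] \<epsilon> by (intro diff_left_mono order_trans[OF S_h] add_left_mono mult_left_mono) auto
    ultimately show ?thesis using \<open>h n y \<le> S (h n)\<close> by linarith
  qed
  with up have "(H y - 2 * \<epsilon>) / 2 ^ n \<le> c / 4 / 2 ^ n" by linarith
  then have "H y - 2 * \<epsilon> \<le> c / 4" unfolding divide_le_cancel by simp
  with Hc c show False by (simp add: \<epsilon>_def)
qed

lemma null_sequence_convex_combination:
  fixes \<phi> :: "nat \<Rightarrow> 'b::topological_space \<Rightarrow> real"
  assumes "compact K" "K \<noteq> {}" "\<And>k. continuous_on K (\<phi> k)"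
    and "\<And>k y. y \<in> K \<Longrightarrow> 0 \<le> \<phi> k y" "\<And>k y. y \<in> K \<Longrightarrow> \<phi> k y \<le> 1"
    and "\<And>y. y \<in> K \<Longrightarrow> (\<lambda>k. \<phi> k y) \<longlonglongrightarrow> 0" "c > 0"
  shows "\<exists>N t. (\<forall>k. 0 \<le> t k) \<and> (\<Sum>k<N. t k) = (1::real) \<and>
    (\<forall>y\<in>K. (\<Sum>k<N. t k * \<phi> k y) \<le> c)"
proof -
  obtain g where g: "g \<in> midpoint_hull \<phi> 0" "\<forall>y\<in>K. g y \<le> c"
    using null_sequence_midpoint_hull[OF assms] by blast
  with midpoint_hull_convex_combination[OF g(1)] show ?thesis by metis
qed

section \<open>Uniform bounds on p-limited sets\<close>

text \<open>The number \<open>C\<close> bounds the \<open>p\<close>-th power of the \<open>p\<close>-summing constant of the evaluation map from the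
  functionals in \<open>\<Phi>\<close> to the bounded functions on \<open>A\<close>. The suprema over \<open>A\<close> are expressed through
  arbitrary choices \<open>x i \<in> A\<close>, and the weights \<open>t\<close> and the constant \<open>M\<close> make the condition
  homogeneous, which spares taking roots when families are rescaled and combined.\<close>

definition summing_bound :: "real \<Rightarrow> 'a::banach set \<Rightarrow> ('a \<Rightarrow>\<^sub>L real) set \<Rightarrow> real \<Rightarrow> bool" where
  "summing_bound p A \<Phi> C \<longleftrightarrow> (\<forall>(I::nat set) t f x M. finite I \<longrightarrow> 0 \<le> M \<longrightarrow>
     (\<forall>i\<in>I. 0 \<le> t i \<and> f i \<in> \<Phi> \<and> x i \<in> A) \<longrightarrow>
     (\<forall>y. (\<Sum>i\<in>I. t i * \<bar>blinfun_apply (f i) y\<bar> powr p) \<le> M * norm y powr p) \<longrightarrow>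
     (\<Sum>i\<in>I. t i * \<bar>blinfun_apply (f i) (x i)\<bar> powr p) \<le> C * M)"

lemma summing_boundD:
  fixes I :: "'i::countable set"
  assumes "summing_bound p A \<Phi> C" "finite I" "0 \<le> M"
    and "\<And>i. i \<in> I \<Longrightarrow> 0 \<le> t i" "\<And>i. i \<in> I \<Longrightarrow> f i \<in> \<Phi>" "\<And>i. i \<in> I \<Longrightarrow> x i \<in> A"
    and "\<And>y. (\<Sum>i\<in>I. t i * \<bar>blinfun_apply (f i) y\<bar> powr p) \<le> M * norm y powr p"
  shows "(\<Sum>i\<in>I. t i * \<bar>blinfun_apply (f i) (x i)\<bar> powr p) \<le> C * M"
proof -
  have re: "(\<Sum>i\<in>to_nat ` I. g (from_nat i)) = (\<Sum>i\<in>I. g i)" for g :: "'i \<Rightarrow> real"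
    by (simp add: sum.reindex)
  have "(\<Sum>i\<in>to_nat ` I. t (from_nat i) * \<bar>blinfun_apply (f (from_nat i)) (x (from_nat i))\<bar> powr p) \<le> C * M"
    by (rule assms(1)[unfolded summing_bound_def, rule_format])
       (use assms(2-) in \<open>auto simp: re[of "\<lambda>i. t i * \<bar>blinfun_apply (f i) _\<bar> powr p"]\<close>)
  then show ?thesis by (simp add: re[of "\<lambda>i. t i * \<bar>blinfun_apply (f i) (x i)\<bar> powr p"])
qed

lemma summing_bound_mono:
  assumes "summing_bound p A \<Phi> C" "\<Psi> \<subseteq> \<Phi>" "C \<le> C'"
  shows "summing_bound p A \<Psi> C'"
  unfolding summing_bound_def
proof (intro allI impI)
  fix I :: "nat set" and t f x and M :: real
  assume a: "finite I" "0 \<le> M" "\<forall>i\<in>I. 0 \<le> t i \<and> f i \<in> \<Psi> \<and> x i \<in> A"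
    "\<forall>y. (\<Sum>i\<in>I. t i * \<bar>blinfun_apply (f i) y\<bar> powr p) \<le> M * norm y powr p"
  have "(\<Sum>i\<in>I. t i * \<bar>blinfun_apply (f i) (x i)\<bar> powr p) \<le> C * M"
    using assms(2) a by (intro summing_boundD[OF assms(1)]) auto
  also have "\<dots> \<le> C' * M" using a assms(3) by (intro mult_right_mono)
  finally show "(\<Sum>i\<in>I. t i * \<bar>blinfun_apply (f i) (x i)\<bar> powr p) \<le> C' * M" .
qed

text \<open>A violating family can be rescaled to \<open>M = 1\<close>. If \<open>M\<close> were \<open>0\<close>, all weighted functionals would
  vanish, and nothing would be violated.\<close>

lemma not_summing_boundE:
  fixes A :: "'a::banach set"
  assumes "\<not> summing_bound p A \<Phi> C"
  obtains I :: "nat set" and t f x where "finite I"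
    "\<And>i. i \<in> I \<Longrightarrow> 0 \<le> t i \<and> f i \<in> \<Phi> \<and> x i \<in> A"
    "\<And>y. (\<Sum>i\<in>I. t i * \<bar>blinfun_apply (f i) y\<bar> powr p) \<le> norm y powr p"
    "C < (\<Sum>i\<in>I. t i * \<bar>blinfun_apply (f i) (x i)\<bar> powr p)"
proof -
  obtain I :: "nat set" and t f x M where I: "finite I" and M: "0 \<le> M"
    and mem: "\<And>i. i \<in> I \<Longrightarrow> 0 \<le> t i \<and> f i \<in> \<Phi> \<and> x i \<in> A"
    and le: "\<And>y. (\<Sum>i\<in>I. t i * \<bar>blinfun_apply (f i) y\<bar> powr p) \<le> M * norm y powr p"
    and gt: "C * M < (\<Sum>i\<in>I. t i * \<bar>blinfun_apply (f i) (x i)\<bar> powr p)"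
    using assms unfolding summing_bound_def not_all not_imp not_le by blast
  have "M \<noteq> 0"
  proof
    assume M: "M = 0"
    have "t i * \<bar>blinfun_apply (f i) y\<bar> powr p = 0" if "i \<in> I" for i y
    proof -
      have "t i * \<bar>blinfun_apply (f i) y\<bar> powr p \<le> (\<Sum>i\<in>I. t i * \<bar>blinfun_apply (f i) y\<bar> powr p)"
        using that I mem by (intro member_le_sum) auto
      with le[of y] M mem[OF that] show ?thesis
        by (intro antisym) auto
    qed
    with gt M show False by simp
  qed
  then have M: "M > 0" using M by simp
  show ?thesis
  proof (rule that[of I "\<lambda>i. t i / M" f x])
    show "(\<Sum>i\<in>I. t i / M * \<bar>blinfun_apply (f i) y\<bar> powr p) \<le> norm y powr p" for y
      using le[of y] M by (simp add: field_simps flip: sum_divide_distrib)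
    show "C < (\<Sum>i\<in>I. t i / M * \<bar>blinfun_apply (f i) (x i)\<bar> powr p)"
      using gt M by (simp add: field_simps flip: sum_divide_distrib)
  qed (use I mem M in auto)
qed

text \<open>A gliding hump. If no constant works, take for each \<open>k\<close> a family that violates \<open>2\<^sup>k\<close> and give it the
  weight \<open>2\<^sup>-\<^sup>k\<close>. All these families together form one weak* \<open>p\<close>-summable sequence, but each contributes at
  least \<open>1\<close> to the sum of the \<open>p\<close>-th powers of any majorant on \<open>A\<close>.\<close>

lemma p_limited_imp_summing_bound:
  fixes A :: "'a::banach set"
  assumes p: "1 \<le> p" and A: "p_limited p A"
  obtains C where "0 < C" "summing_bound p A UNIV C"
proof -
  have "\<exists>k::nat. summing_bound p A UNIV (2 ^ k)"
  proof (rule ccontr)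
    assume contra: "\<not> ?thesis"
    define Q where "Q k I t f x \<longleftrightarrow> finite (I::nat set) \<and> (\<forall>i\<in>I. 0 \<le> t i \<and> x i \<in> A) \<and>
      (\<forall>y. (\<Sum>i\<in>I. t i * \<bar>blinfun_apply (f i) y\<bar> powr p) \<le> norm y powr p) \<and>
      2 ^ k < (\<Sum>i\<in>I. t i * \<bar>blinfun_apply (f i) (x i)\<bar> powr p)" for k :: nat and I t f x
    have "\<exists>I t f x. Q k I t f x" for k
    proof -
      have "\<not> summing_bound p A UNIV (2 ^ k)" using contra by blast
      then show ?thesis unfolding Q_def by (rule not_summing_boundE) blast
    qed
    then obtain I t f x where Q: "\<And>k. Q k (I k) (t k) (f k) (x k)" by metis
    have I: "\<And>k. finite (I k)" and t: "\<And>k i. i \<in> I k \<Longrightarrow> 0 \<le> t k i" and x: "\<And>k i. i \<in> I k \<Longrightarrow> x k i \<in> A"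
      and le: "\<And>k y. (\<Sum>i\<in>I k. t k i * \<bar>blinfun_apply (f k i) y\<bar> powr p) \<le> norm y powr p"
      and gt: "\<And>k. 2 ^ k < (\<Sum>i\<in>I k. t k i * \<bar>blinfun_apply (f k i) (x k i)\<bar> powr p)"
      using Q unfolding Q_def by blast+
    define s where "s k i = (if i \<in> I k then t k i / 2 ^ k else 0)" for k i
    have s: "s k i \<ge> 0" for k i using t by (simp add: s_def)
    define g where "g = (\<lambda>(k, i). (s k i powr (1 / p)) *\<^sub>R f k i)"
    have g: "\<bar>blinfun_apply (g (k, i)) y\<bar> powr p = s k i * \<bar>blinfun_apply (f k i) y\<bar> powr p" for k i y
      using p s[of k i] by (simp add: g_def blinfun.scaleR_left abs_mult powr_mult powr_powr)
    have g_sum: "(\<Sum>i\<in>I k. \<bar>blinfun_apply (g (k, i)) y\<bar> powr p)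
        = (\<Sum>i\<in>I k. t k i * \<bar>blinfun_apply (f k i) y\<bar> powr p) / 2 ^ k" for k y
      by (simp add: g s_def sum_divide_distrib)
    have "weak_star_p_summable p (\<lambda>n. g (prod_decode n))"
      unfolding weak_star_p_summable_def ell_def
    proof (intro allI, simp)
      fix y
      define w where "w z = \<bar>blinfun_apply (g z) y\<bar> powr p" for z
      have "(\<Sum>n<N. w (prod_decode n)) \<le> 2 * norm y powr p" for N
      proof -
        define F where "F = prod_decode ` {..<N}"
        obtain K where K: "fst ` F \<subseteq> {..<K}"
          using finite_nat_iff_bounded[of "fst ` F"] by (auto simp: F_def)
        have "(\<Sum>n<N. w (prod_decode n)) = sum w F"
          unfolding F_def by (subst sum.reindex) (auto simp: inj_on_def prod_decode_eq)
        also have "\<dots> = sum w (F \<inter> Sigma {..<K} I)"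
        proof (rule sum.mono_neutral_right)
          show "\<forall>z\<in>F - F \<inter> Sigma {..<K} I. w z = 0"
          proof
            fix z assume z: "z \<in> F - F \<inter> Sigma {..<K} I"
            obtain k i where ki: "z = (k, i)" by (cases z)
            have "i \<notin> I k" using z K ki by force
            then show "w z = 0" unfolding w_def ki g by (simp add: s_def)
          qed
        qed (auto simp: F_def)
        also have "\<dots> \<le> sum w (Sigma {..<K} I)"
          using I by (intro sum_mono2) (auto simp: w_def)
        also have "\<dots> = (\<Sum>k<K. \<Sum>i\<in>I k. w (k, i))"
          using I by (subst sum.Sigma) (auto simp: case_prod_unfold)
        also have "\<dots> \<le> (\<Sum>k<K. norm y powr p * (1 / 2) ^ k)"
          unfolding w_def g_sum using le by (intro sum_mono) (simp add: power_divide divide_right_mono)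
        also have "\<dots> = norm y powr p * (\<Sum>k<K. (1 / 2) ^ k)"
          by (simp add: sum_distrib_left)
        also have "\<dots> \<le> norm y powr p * 2"
          by (intro mult_left_mono) (simp_all add: sum_gp_strict)
        finally show ?thesis by simp
      qed
      then show "summable (\<lambda>n. \<bar>blinfun_apply (g (prod_decode n)) y\<bar> powr p)"
        by (intro summableI_nonneg_bounded[where x = "2 * norm y powr p"]) (auto simp: w_def)
    qed
    then obtain a where a: "a \<in> ell (ereal p)" "\<And>x n. x \<in> A \<Longrightarrow> \<bar>blinfun_apply (g (prod_decode n)) x\<bar> \<le> a n"
      using A unfolding p_limited_def by blast
    have a_sum: "summable (\<lambda>n. \<bar>a n\<bar> powr p)" using a(1) by (simp add: ell_def)
    have "real N \<le> (\<Sum>n. \<bar>a n\<bar> powr p)" for N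
    proof -
      define w where "w = (\<lambda>(k, i). \<bar>blinfun_apply (g (k, i)) (x k i)\<bar> powr p)"
      have "real N = (\<Sum>k<N. 1)" by simp
      also have "\<dots> \<le> (\<Sum>k<N. \<Sum>i\<in>I k. w (k, i))"
      proof (rule sum_mono)
        fix k
        have "(\<Sum>i\<in>I k. w (k, i)) = (\<Sum>i\<in>I k. t k i * \<bar>blinfun_apply (f k i) (x k i)\<bar> powr p) / 2 ^ k"
          by (simp add: w_def g s_def sum_divide_distrib)
        then show "1 \<le> (\<Sum>i\<in>I k. w (k, i))" using gt[of k] by (simp add: less_imp_le)
      qed
      also have "\<dots> = sum w (Sigma {..<N} I)"
        using I by (subst sum.Sigma) (auto simp: case_prod_unfold)
      also have "\<dots> \<le> (\<Sum>z\<in>Sigma {..<N} I. \<bar>a (prod_encode z)\<bar> powr p)"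
      proof (rule sum_mono)
        fix z assume z: "z \<in> Sigma {..<N} I"
        then obtain k i where ki: "z = (k, i)" "i \<in> I k" by auto
        then show "w z \<le> \<bar>a (prod_encode z)\<bar> powr p"
          using a(2)[OF x[OF ki(2)], of "prod_encode z"] p by (auto simp: w_def intro!: powr_mono2)
      qed
      also have "\<dots> = (\<Sum>n\<in>prod_encode ` Sigma {..<N} I. \<bar>a n\<bar> powr p)"
        by (subst sum.reindex) (auto simp: inj_on_def prod_encode_eq)
      also have "\<dots> \<le> (\<Sum>n. \<bar>a n\<bar> powr p)"
        using I by (intro sum_le_suminf a_sum) auto
      finally show ?thesis .
    qed
    then show False using reals_Archimedean2[of "\<Sum>n. \<bar>a n\<bar> powr p"] by (meson not_le)
  qed
  then show ?thesis using that by (meson zero_less_numeral zero_less_power)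
qed

section \<open>Boundedly complete systems of coordinates\<close>

text \<open>A system of unit vectors with biorthogonal coordinate functionals that behaves like a boundedly
  complete unconditional basis. The set \<open>\<Gamma>\<close> may be uncountable.\<close>

locale boundedly_complete_system =
  fixes \<Gamma> :: "'a::banach set" and coord :: "'a \<Rightarrow> 'a \<Rightarrow>\<^sub>L real"
  assumes norm_atom: "a \<in> \<Gamma> \<Longrightarrow> norm a = 1"
    and biorthogonal: "a \<in> \<Gamma> \<Longrightarrow> b \<in> \<Gamma> \<Longrightarrow> coord a b = (if a = b then 1 else 0)"
    and contractive: "finite F \<Longrightarrow> F \<subseteq> \<Gamma> \<Longrightarrow> norm (\<Sum>a\<in>F. coord a x *\<^sub>R a) \<le> norm x"
    and total: "(\<And>a. a \<in> \<Gamma> \<Longrightarrow> coord a x = 0) \<Longrightarrow> x = 0"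
    and boundedly_complete: "incseq G \<Longrightarrow> (\<And>k. finite (G k)) \<Longrightarrow> (\<And>k. G k \<subseteq> \<Gamma>) \<Longrightarrow>
      bounded (range (\<lambda>k. \<Sum>a\<in>G k. \<eta> a *\<^sub>R a)) \<Longrightarrow> convergent (\<lambda>k. \<Sum>a\<in>G k. \<eta> a *\<^sub>R a)"
begin

definition proj :: "'a set \<Rightarrow> 'a \<Rightarrow> 'a" where
  "proj F x = (\<Sum>a\<in>F. coord a x *\<^sub>R a)"

lemma norm_proj_le: "finite F \<Longrightarrow> F \<subseteq> \<Gamma> \<Longrightarrow> norm (proj F x) \<le> norm x"
  using contractive by (simp add: proj_def)

lemma coord_sum:
  assumes "finite F" "F \<subseteq> \<Gamma>" "a \<in> \<Gamma>"
  shows "coord a (\<Sum>b\<in>F. \<eta> b *\<^sub>R b) = (if a \<in> F then \<eta> a else 0)"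
proof -
  have "coord a (\<Sum>b\<in>F. \<eta> b *\<^sub>R b) = (\<Sum>b\<in>F. \<eta> b * coord a b)"
    by (simp add: blinfun.sum_right blinfun.scaleR_right)
  also have "\<dots> = (\<Sum>b\<in>F. if a = b then \<eta> b else 0)"
    using assms by (intro sum.cong) (auto simp: biorthogonal)
  also have "\<dots> = (if a \<in> F then \<eta> a else 0)" using assms(1) by simp
  finally show ?thesis .
qed

lemma coord_proj:
  assumes "finite F" "F \<subseteq> \<Gamma>" "a \<in> \<Gamma>"
  shows "coord a (proj F x) = (if a \<in> F then coord a x else 0)"
  unfolding proj_def using assms by (rule coord_sum)

lemma proj_proj: "finite G \<Longrightarrow> G \<subseteq> \<Gamma> \<Longrightarrow> F \<subseteq> G \<Longrightarrow> proj F (proj G x) = proj F x"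
  unfolding proj_def[of F] by (intro sum.cong) (auto simp: coord_proj subset_iff)

lemma proj_idem: "finite F \<Longrightarrow> F \<subseteq> \<Gamma> \<Longrightarrow> proj F (proj F x) = proj F x"
  by (simp add: proj_proj)

lemma proj_scaleR: "proj F (c *\<^sub>R x) = c *\<^sub>R proj F x"
  by (simp add: proj_def blinfun.scaleR_right scaleR_sum_right)

lemma proj_sum: "proj F (\<Sum>i\<in>I. x i) = (\<Sum>i\<in>I. proj F (x i))"
  unfolding proj_def by (simp add: blinfun.sum_right scaleR_sum_left) (rule sum.swap)

lemma abs_coord_le: "a \<in> \<Gamma> \<Longrightarrow> \<bar>coord a x\<bar> \<le> norm x"
  using norm_proj_le[of "{a}" x] norm_atom[of a] by (simp add: proj_def)

lemma norm_sum_atoms_mono: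
  assumes "finite F" "F \<subseteq> \<Gamma>" "G \<subseteq> F"
  shows "norm (\<Sum>a\<in>G. \<eta> a *\<^sub>R a) \<le> norm (\<Sum>a\<in>F. \<eta> a *\<^sub>R a)"
proof -
  have "(\<Sum>a\<in>G. \<eta> a *\<^sub>R a) = proj G (\<Sum>a\<in>F. \<eta> a *\<^sub>R a)"
    unfolding proj_def using assms by (intro sum.cong) (auto simp: coord_sum subset_iff)
  then show ?thesis using assms norm_proj_le[of G] by (metis finite_subset subset_trans)
qed

text \<open>The functionals that depend on finitely many coordinates, all outside \<open>F\<close>.\<close>

definition tail_functionals :: "'a set \<Rightarrow> ('a \<Rightarrow>\<^sub>L real) set" where
  "tail_functionals F = {f. \<exists>G. finite G \<and> G \<subseteq> \<Gamma> - F \<and> (\<forall>y. blinfun_apply f y = blinfun_apply f (proj G y))}"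

lemma tail_functionals_antimono: "F \<subseteq> F' \<Longrightarrow> tail_functionals F' \<subseteq> tail_functionals F"
  unfolding tail_functionals_def by blast

lemma tail_functionals_common_support:
  fixes f :: "'i \<Rightarrow> 'a \<Rightarrow>\<^sub>L real"
  assumes "finite I" "\<And>i. i \<in> I \<Longrightarrow> f i \<in> tail_functionals F"
  obtains G where "finite G" "G \<subseteq> \<Gamma> - F" "\<And>i y. i \<in> I \<Longrightarrow> blinfun_apply (f i) y = blinfun_apply (f i) (proj G y)"
proof -
  have "\<forall>i\<in>I. \<exists>G. finite G \<and> G \<subseteq> \<Gamma> - F \<and> (\<forall>y. blinfun_apply (f i) y = blinfun_apply (f i) (proj G y))"
    using assms(2) by (auto simp: tail_functionals_def)
  then obtain G where G: "\<And>i. i \<in> I \<Longrightarrow> finite (G i)" "\<And>i. i \<in> I \<Longrightarrow> G i \<subseteq> \<Gamma> - F"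
    "\<And>i y. i \<in> I \<Longrightarrow> blinfun_apply (f i) y = blinfun_apply (f i) (proj (G i) y)" by metis
  have fin: "finite (\<Union>i\<in>I. G i)" and sub: "(\<Union>i\<in>I. G i) \<subseteq> \<Gamma> - F" using assms(1) G by auto
  have "blinfun_apply (f i) y = blinfun_apply (f i) (proj (\<Union>i\<in>I. G i) y)" if "i \<in> I" for i y
  proof -
    have "proj (G i) (proj (\<Union>i\<in>I. G i) y) = proj (G i) y"
      using that fin sub by (intro proj_proj) auto
    then show ?thesis using G(3)[OF that] by metis
  qed
  with fin sub show ?thesis using that by blast
qed

text \<open>The partial sums over the \<open>F k\<close> are bounded, hence convergent by bounded completeness, and
  \<open>G k\<close> only sees the difference of two consecutive ones.\<close>

lemma blocks_tendsto_0:
  assumes "incseq F" "\<And>k. finite (F k)" "\<And>k. F k \<subseteq> \<Gamma>"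
    and "\<And>k. G k \<subseteq> F (Suc k) - F k" "\<And>k. norm (\<Sum>a\<in>F k. \<eta> a *\<^sub>R a) \<le> B"
  shows "(\<lambda>k. norm (\<Sum>a\<in>G k. \<eta> a *\<^sub>R a)) \<longlonglongrightarrow> 0"
proof -
  define s where "s k = (\<Sum>a\<in>F k. \<eta> a *\<^sub>R a)" for k
  have "convergent s"
    unfolding s_def using assms by (intro boundedly_complete) (auto simp: bounded_iff)
  then obtain L where "s \<longlonglongrightarrow> L" by (auto simp: convergent_def)
  then have "(\<lambda>k. s (Suc k) - s k) \<longlonglongrightarrow> L - L" by (intro tendsto_diff LIMSEQ_Suc)
  then have lim: "(\<lambda>k. norm (s (Suc k) - s k)) \<longlonglongrightarrow> 0" using tendsto_norm_zero by auto
  show ?thesis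
  proof (rule tendsto_sandwich[OF _ _ tendsto_const lim])
    have "norm (\<Sum>a\<in>G k. \<eta> a *\<^sub>R a) \<le> norm (s (Suc k) - s k)" for k
    proof -
      have "s (Suc k) - s k = (\<Sum>a\<in>F (Suc k) - F k. \<eta> a *\<^sub>R a)"
        unfolding s_def using assms(2) incseq_SucD[OF assms(1), of k] by (simp add: sum_diff)
      then show ?thesis
        using norm_sum_atoms_mono[of "F (Suc k) - F k" "G k"] assms(2,3,4) by (metis Diff_subset finite_Diff subset_trans)
    qed
    then show "\<forall>\<^sub>F k in sequentially. norm (\<Sum>a\<in>G k. \<eta> a *\<^sub>R a) \<le> norm (s (Suc k) - s k)"
      by simp
  qed simp
qed

text \<open>Suppose that no finite \<open>F\<close> works. Adding to \<open>F\<close> the support of a violating family and repeating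
  gives disjoint finite blocks \<open>G k\<close>, each carrying a family whose sum on \<open>A\<close> exceeds \<open>c\<close> and which is
  dominated at \<open>y\<close> by \<open>\<parallel>proj (G k) y\<parallel>\<^sup>p\<close>. By bounded completeness and Simons' lemma there are convex
  weights \<open>t\<close> with \<open>\<Sum>t\<^sub>k \<parallel>proj (G k) y\<parallel>\<^sup>p \<le> c / (C + 1) \<cdot> \<parallel>y\<parallel>\<^sup>p\<close>. The union of the families with these
  weights then has a sum on \<open>A\<close> of at most \<open>C \<cdot> c / (C + 1) < c\<close>, but also one of at least \<open>c\<close>.\<close>

lemma small_tail_summing_bound:
  assumes p: "1 \<le> p" and A: "summing_bound p A UNIV C" and C: "0 < C" and c: "0 < c"
  obtains F where "finite F" "F \<subseteq> \<Gamma>" "summing_bound p A (tail_functionals F) c"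
proof (rule ccontr)
  assume contra: "\<not> ?thesis"
  define Q where "Q F G I s f x \<longleftrightarrow> finite G \<and> G \<subseteq> \<Gamma> - F \<and> finite (I::nat set) \<and>
    (\<forall>i\<in>I. 0 \<le> s i \<and> x i \<in> A) \<and>
    (\<forall>y. (\<Sum>i\<in>I. s i * \<bar>blinfun_apply (f i) y\<bar> powr p) \<le> norm (proj G y) powr p) \<and>
    c < (\<Sum>i\<in>I. s i * \<bar>blinfun_apply (f i) (x i)\<bar> powr p)" for F G I s f x
  have ex: "\<exists>G I s f x. finite F \<longrightarrow> F \<subseteq> \<Gamma> \<longrightarrow> Q F G I s f x" for F
  proof (cases "finite F \<and> F \<subseteq> \<Gamma>")
    case True
    then have "\<not> summing_bound p A (tail_functionals F) c" using contra that by blast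
    then obtain I :: "nat set" and s f x where I: "finite I"
      and mem: "\<And>i. i \<in> I \<Longrightarrow> 0 \<le> s i \<and> f i \<in> tail_functionals F \<and> x i \<in> A"
      and le: "\<And>y. (\<Sum>i\<in>I. s i * \<bar>blinfun_apply (f i) y\<bar> powr p) \<le> norm y powr p"
      and gt: "c < (\<Sum>i\<in>I. s i * \<bar>blinfun_apply (f i) (x i)\<bar> powr p)"
      by (rule not_summing_boundE) blast
    obtain G where G: "finite G" "G \<subseteq> \<Gamma> - F" "\<And>i y. i \<in> I \<Longrightarrow> blinfun_apply (f i) y = blinfun_apply (f i) (proj G y)"
      using tail_functionals_common_support[OF I, of f F] mem by blast
    have "(\<Sum>i\<in>I. s i * \<bar>blinfun_apply (f i) y\<bar> powr p) \<le> norm (proj G y) powr p" for y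
      using le[of "proj G y"] by (simp flip: G(3) cong: sum.cong)
    then have "Q F G I s f x" using I G mem gt unfolding Q_def by blast
    then show ?thesis by blast
  qed auto
  then obtain g I s f x where
    Q': "\<And>F. finite F \<longrightarrow> F \<subseteq> \<Gamma> \<longrightarrow> Q F (g F) (I F) (s F) (f F) (x F)" by metis
  then have Q: "Q F (g F) (I F) (s F) (f F) (x F)" if "finite F" "F \<subseteq> \<Gamma>" for F
    using that by simp
  define F where "F = rec_nat {} (\<lambda>_ F. F \<union> g F)"
  have F_0: "F 0 = {}" and F_Suc: "F (Suc k) = F k \<union> g (F k)" for k by (simp_all add: F_def)
  have F: "finite (F k) \<and> F k \<subseteq> \<Gamma>" for k
  proof (induction k)
    case (Suc k)
    then show ?case using Q[of "F k"] by (auto simp: F_Suc Q_def)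
  qed (simp add: F_0)
  have incF: "incseq F" by (rule incseq_SucI) (simp add: F_Suc)
  define G where "G k = g (F k)" for k
  have QF: "Q (F k) (G k) (I (F k)) (s (F k)) (f (F k)) (x (F k))" for k
    unfolding G_def using F by (intro Q) auto
  have G: "G k \<subseteq> F (Suc k) - F k" "finite (G k)" "G k \<subseteq> \<Gamma>" for k
    using QF[of k] by (auto simp: Q_def F_Suc G_def)
  \<comment> \<open>\<open>K\<close> contains the coordinates of the unit ball, and it is compact as a closed subset of a
    cube of coefficient functions.\<close>
  define K where "K = {\<eta> :: 'a \<Rightarrow> real. (\<forall>a. \<bar>\<eta> a\<bar> \<le> 1) \<and> (\<forall>k. norm (\<Sum>a\<in>F k. \<eta> a *\<^sub>R a) \<le> 1)}"
  define \<phi> where "\<phi> k \<eta> = norm (\<Sum>a\<in>G k. \<eta> a *\<^sub>R a) powr p" for k and \<eta> :: "'a \<Rightarrow> real"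
  have "compact K"
  proof -
    have "closed (\<Inter>k. {\<eta> :: 'a \<Rightarrow> real. norm (\<Sum>a\<in>F k. \<eta> a *\<^sub>R a) \<le> 1})"
      by (intro closed_INT ballI closed_Collect_le continuous_intros continuous_on_product_coordinates)
    moreover have "K = PiE UNIV (\<lambda>_. {-1..1}) \<inter> (\<Inter>k. {\<eta>. norm (\<Sum>a\<in>F k. \<eta> a *\<^sub>R a) \<le> 1})"
      by (auto simp: K_def PiE_def abs_le_iff minus_le_iff)
    ultimately show ?thesis by (simp add: compact_cube compact_Int_closed)
  qed
  moreover have "K \<noteq> {}" by (auto simp: K_def intro!: exI[of _ "\<lambda>_. 0"])
  moreover have "continuous_on K (\<phi> k)" for k
    unfolding \<phi>_def using p
    by (intro continuous_intros continuous_on_powr' continuous_on_subset[OF continuous_on_product_coordinates]) auto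
  moreover have "0 \<le> \<phi> k \<eta>" if "\<eta> \<in> K" for k \<eta> by (simp add: \<phi>_def)
  moreover have "\<phi> k \<eta> \<le> 1" if "\<eta> \<in> K" for k \<eta>
  proof -
    have "norm (\<Sum>a\<in>G k. \<eta> a *\<^sub>R a) \<le> norm (\<Sum>a\<in>F (Suc k). \<eta> a *\<^sub>R a)"
      using F[of "Suc k"] G(1)[of k] by (intro norm_sum_atoms_mono) auto
    also have "\<dots> \<le> 1" using that unfolding K_def by blast
    finally show ?thesis using p by (simp add: \<phi>_def powr_le_one_le powr_le1)
  qed
  moreover have "(\<lambda>k. \<phi> k \<eta>) \<longlonglongrightarrow> 0" if "\<eta> \<in> K" for \<eta>
  proof -
    have "(\<lambda>k. norm (\<Sum>a\<in>G k. \<eta> a *\<^sub>R a)) \<longlonglongrightarrow> 0"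
      using incF F G that by (intro blocks_tendsto_0[where F=F and B=1]) (auto simp: K_def)
    then have "(\<lambda>k. \<phi> k \<eta>) \<longlonglongrightarrow> 0 powr p"
      unfolding \<phi>_def using p by (intro tendsto_powr2 tendsto_const) auto
    then show ?thesis by simp
  qed
  moreover have "0 < c / (C + 1)" using c C by simp
  ultimately have "\<exists>N t. (\<forall>k. 0 \<le> t k) \<and> (\<Sum>k<N. t k) = (1::real) \<and>
    (\<forall>\<eta>\<in>K. (\<Sum>k<N. t k * \<phi> k \<eta>) \<le> c / (C + 1))"
    by (rule null_sequence_convex_combination)
  then obtain N t where t: "\<And>k. 0 \<le> t k" "(\<Sum>k<N. t k) = (1::real)"
    "\<And>\<eta>. \<eta> \<in> K \<Longrightarrow> (\<Sum>k<N. t k * \<phi> k \<eta>) \<le> c / (C + 1)"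
    by auto
  have blocks: "(\<Sum>k<N. t k * norm (proj (G k) y) powr p) \<le> c / (C + 1) * norm y powr p" for y
  proof (cases "y = 0")
    case True
    then show ?thesis using p by (simp add: proj_def)
  next
    case False
    define \<eta> where "\<eta> a = (if a \<in> \<Gamma> then coord a y / norm y else 0)" for a
    have sum_\<eta>: "(\<Sum>a\<in>H. \<eta> a *\<^sub>R a) = proj H y /\<^sub>R norm y" if "H \<subseteq> \<Gamma>" for H
      unfolding proj_def scaleR_sum_right using that
      by (intro sum.cong) (auto simp: \<eta>_def divide_inverse mult_ac)
    have "\<eta> \<in> K"
      unfolding K_def
    proof (intro CollectI conjI allI)
      show "\<bar>\<eta> a\<bar> \<le> 1" for a using abs_coord_le[of a y] False by (simp add: \<eta>_def)
      show "norm (\<Sum>a\<in>F k. \<eta> a *\<^sub>R a) \<le> 1" for k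
        using F[of k] norm_proj_le[of "F k" y] False by (simp add: sum_\<eta> field_simps)
    qed
    moreover have "\<phi> k \<eta> = norm (proj (G k) y) powr p / norm y powr p" for k
      unfolding \<phi>_def sum_\<eta>[OF G(3)] by (simp add: powr_divide divide_inverse[symmetric] mult.commute flip: divide_inverse_commute)
    ultimately have "(\<Sum>k<N. t k * (norm (proj (G k) y) powr p / norm y powr p)) \<le> c / (C + 1)"
      using t(3)[of \<eta>] by simp
    then have "(\<Sum>k<N. t k * norm (proj (G k) y) powr p) / norm y powr p \<le> c / (C + 1)"
      by (simp add: sum_divide_distrib)
    then show ?thesis using False by (simp add: pos_divide_le_eq)
  qed
  define W where "W = (SIGMA k:{..<N}. I (F k))"
  have I: "finite (I (F k))" for k using QF[of k] by (simp add: Q_def)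
  have fin: "finite W" unfolding W_def using I by auto
  have sum_W: "(\<Sum>z\<in>W. h (fst z) (snd z)) = (\<Sum>k<N. \<Sum>i\<in>I (F k). h k i)" for h :: "nat \<Rightarrow> nat \<Rightarrow> real"
    unfolding W_def using I by (subst sum.Sigma) (auto simp: case_prod_unfold)
  have "(\<Sum>z\<in>W. (t (fst z) * s (F (fst z)) (snd z)) *
      \<bar>blinfun_apply (f (F (fst z)) (snd z)) (x (F (fst z)) (snd z))\<bar> powr p) \<le> C * (c / (C + 1))"
  proof (rule summing_boundD[OF A fin])
    show "0 \<le> c / (C + 1)" using c C by simp
    fix z assume "z \<in> W"
    then show "0 \<le> t (fst z) * s (F (fst z)) (snd z)" "x (F (fst z)) (snd z) \<in> A"
      using QF t(1) by (auto simp: W_def Q_def)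
  next
    fix y
    have "(\<Sum>z\<in>W. (t (fst z) * s (F (fst z)) (snd z)) * \<bar>blinfun_apply (f (F (fst z)) (snd z)) y\<bar> powr p)
      = (\<Sum>k<N. t k * (\<Sum>i\<in>I (F k). s (F k) i * \<bar>blinfun_apply (f (F k) i) y\<bar> powr p))"
      by (subst sum_W) (simp add: sum_distrib_left mult.assoc)
    also have "\<dots> \<le> (\<Sum>k<N. t k * norm (proj (G k) y) powr p)"
      using QF t(1) by (intro sum_mono mult_left_mono) (auto simp: Q_def)
    also have "\<dots> \<le> c / (C + 1) * norm y powr p" by (rule blocks)
    finally show "(\<Sum>z\<in>W. (t (fst z) * s (F (fst z)) (snd z)) *
      \<bar>blinfun_apply (f (F (fst z)) (snd z)) y\<bar> powr p) \<le> c / (C + 1) * norm y powr p" .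
  qed auto
  also have "C * (c / (C + 1)) < c" using c C by (simp add: field_simps)
  also have "c = (\<Sum>k<N. t k * c)" using t(2) by (simp flip: sum_distrib_right)
  also have "\<dots> \<le> (\<Sum>k<N. t k * (\<Sum>i\<in>I (F k). s (F k) i * \<bar>blinfun_apply (f (F k) i) (x (F k) i)\<bar> powr p))"
    using QF t(1) by (intro sum_mono mult_left_mono) (auto simp: Q_def less_imp_le)
  also have "\<dots> = (\<Sum>z\<in>W. (t (fst z) * s (F (fst z)) (snd z)) *
      \<bar>blinfun_apply (f (F (fst z)) (snd z)) (x (F (fst z)) (snd z))\<bar> powr p)"
    by (subst sum_W) (simp add: sum_distrib_left mult.assoc)
  finally show False by simp
qed

lemma coord_powr_le:
  assumes p: "1 \<le> p" and A: "summing_bound p A (tail_functionals F) c"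
    and a: "a \<in> \<Gamma> - F" and x: "x \<in> A"
  shows "\<bar>coord a x\<bar> powr p \<le> c"
proof -
  have "coord a \<in> tail_functionals F"
    unfolding tail_functionals_def using a
    by (intro CollectI exI[of _ "{a}"]) (auto simp: coord_proj)
  then have "(\<Sum>i\<in>{0::nat}. 1 * \<bar>coord a x\<bar> powr p) \<le> c * 1"
    using a x p abs_coord_le
    by (intro summing_boundD[OF A]) (auto intro!: powr_mono2)
  then show ?thesis by simp
qed

text \<open>Pietsch domination on a finite block, with an additive error: the functionals \<open>\<Sum>b\<^sub>a coord a\<close> are
  bounded on \<open>A\<close> by \<open>c\<close> times their \<open>p\<close>-th mean over finitely many points \<open>y i\<close> of the unit ball. By the
  summing bound, for every weighted finite family of functionals some point of the ball satisfies the
  averaged inequality, and approachability exchanges the quantifiers. As approachability handles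
  finitely many payoffs only, the coefficients \<open>b\<close> are first restricted to a finite grid in the cube;
  uniform continuity of \<open>\<bar>s\<bar>\<^sup>p\<close> extends the result to the whole cube.\<close>

lemma block_domination:
  assumes p: "1 \<le> p" and A: "summing_bound p A (tail_functionals F) c" "A \<noteq> {}" and c: "0 < c"
    and J: "finite J" "J \<subseteq> \<Gamma> - F" and e: "0 < e"
  shows "\<exists>(T::nat) (y :: nat \<Rightarrow> 'a). T > 0 \<and> (\<forall>i<T. norm (y i) \<le> 1) \<and>
    (\<forall>b. \<forall>x\<in>A. (\<forall>a\<in>J. \<bar>b a\<bar> \<le> 1) \<longrightarrow>
      \<bar>\<Sum>a\<in>J. b a * coord a x\<bar> powr p
        \<le> c * ((\<Sum>i<T. \<bar>\<Sum>a\<in>J. b a * coord a (y i)\<bar> powr p) / real T) + e)"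
proof -
  define f where "f b = (\<Sum>a\<in>J. b a *\<^sub>R coord a)" for b
  have f: "blinfun_apply (f b) y = (\<Sum>a\<in>J. b a * coord a y)" for b y
    by (simp add: f_def blinfun.sum_left blinfun.scaleR_left)
  have f_tail: "f b \<in> tail_functionals F" for b
    unfolding tail_functionals_def
  proof (intro CollectI exI conjI allI)
    show "blinfun_apply (f b) y = blinfun_apply (f b) (proj J y)" for y
      unfolding f using J by (intro sum.cong) (auto simp: coord_proj subset_iff)
  qed (use J in auto)
  define L where "L = c powr (1 / p)"
  have L: "L \<ge> 0" by (simp add: L_def)
  have coord_A: "\<bar>coord a x\<bar> \<le> L" if ax: "a \<in> J" "x \<in> A" for a x
  proof -
    have "\<bar>coord a x\<bar> powr p \<le> c"
      using J ax by (intro coord_powr_le[OF p A(1)]) auto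
    then have "(\<bar>coord a x\<bar> powr p) powr (1 / p) \<le> c powr (1 / p)"
      using p by (intro powr_mono2) auto
    then show ?thesis using p by (simp add: L_def powr_powr)
  qed
  define d where "d = real (card J)"
  have f_le: "\<bar>blinfun_apply (f b) y\<bar> \<le> d * (m * r)"
    if "\<And>a. a \<in> J \<Longrightarrow> \<bar>b a\<bar> \<le> m" "\<And>a. a \<in> J \<Longrightarrow> \<bar>coord a y\<bar> \<le> r" for b y m r
  proof -
    have "\<bar>blinfun_apply (f b) y\<bar> \<le> (\<Sum>a\<in>J. \<bar>b a\<bar> * \<bar>coord a y\<bar>)"
      unfolding f using sum_abs[of "\<lambda>a. b a * coord a y" J] by (simp add: abs_mult)
    also have "\<dots> \<le> (\<Sum>a\<in>J. m * r)"
    proof (rule sum_mono)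
      fix a assume a: "a \<in> J"
      show "\<bar>b a\<bar> * \<bar>coord a y\<bar> \<le> m * r"
        using that(1)[OF a] that(2)[OF a] abs_ge_zero[of "b a"] by (intro mult_mono) linarith+
    qed
    finally show ?thesis by (simp add: d_def)
  qed
  define R where "R = d * (1 * (L + 1))"
  have f_R: "\<bar>blinfun_apply (f b) y\<bar> \<le> R"
    if "\<And>a. a \<in> J \<Longrightarrow> \<bar>b a\<bar> \<le> 1" "y \<in> A \<or> norm y \<le> 1" for b y
    unfolding R_def
  proof (rule f_le)
    show "\<bar>coord a y\<bar> \<le> L + 1" if "a \<in> J" for a
      using \<open>y \<in> A \<or> norm y \<le> 1\<close> coord_A[OF that, of y] abs_coord_le[of a y] that J L by force
  qed (use that in auto)
  define \<epsilon> where "\<epsilon> = e / (c + 4)"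
  have \<epsilon>: "\<epsilon> > 0" using e c by (simp add: \<epsilon>_def)
  have "uniformly_continuous_on {-R..R} (\<lambda>s. \<bar>s\<bar> powr p)"
    using p by (intro compact_uniformly_continuous continuous_intros continuous_on_powr') auto
  then obtain \<delta> where \<delta>: "\<delta> > 0"
    "\<And>s s'. \<bar>s\<bar> \<le> R \<Longrightarrow> \<bar>s'\<bar> \<le> R \<Longrightarrow> \<bar>s' - s\<bar> < \<delta> \<Longrightarrow> \<bar>\<bar>s'\<bar> powr p - \<bar>s\<bar> powr p\<bar> < \<epsilon>"
    using \<epsilon> unfolding uniformly_continuous_on_def dist_real_def
    by (metis abs_le_iff atLeastAtMost_iff minus_le_iff)
  obtain N :: nat where N: "R / \<delta> < real N" using reals_Archimedean2 by blast
  have R0: "R \<ge> 0" using L by (simp add: R_def d_def)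
  have N0: "real N > 0" using N R0 \<delta>(1) by (meson divide_nonneg_pos le_less_trans)
  \<comment> \<open>The mesh \<open>1 / N\<close> changes the value of a functional by at most \<open>R / N < \<delta>\<close>.\<close>
  define grid where "grid = PiE J (\<lambda>_. (\<lambda>i::int. of_int i / real N) ` {- int N..int N})"
  have fin_grid: "finite grid" unfolding grid_def using J by (intro finite_PiE) auto
  have grid_le: "\<bar>b a\<bar> \<le> 1" if ba: "b \<in> grid" "a \<in> J" for b a
  proof -
    have "b a \<in> (\<lambda>i::int. of_int i / real N) ` {- int N..int N}"
      using ba unfolding grid_def by (rule PiE_mem)
    then obtain i where i: "- int N \<le> i" "i \<le> int N" "b a = of_int i / real N" by auto
    then have "\<bar>real_of_int i\<bar> \<le> real N" by linarith
    then show ?thesis using N0 unfolding i(3) by (simp add: abs_divide)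
  qed
  have near_grid: "\<exists>b'\<in>grid. \<forall>y. y \<in> A \<or> norm y \<le> 1 \<longrightarrow>
      \<bar>\<bar>blinfun_apply (f b) y\<bar> powr p - \<bar>blinfun_apply (f b') y\<bar> powr p\<bar> < \<epsilon>"
    if b: "\<And>a. a \<in> J \<Longrightarrow> \<bar>b a\<bar> \<le> 1" for b
  proof -
    define b' where "b' = (\<lambda>a\<in>J. of_int \<lfloor>b a * real N\<rfloor> / real N)"
    have b': "b' \<in> grid"
      unfolding grid_def b'_def
    proof (intro restrict_PiE_iff[THEN iffD2] ballI imageI)
      fix a assume "a \<in> J"
      then have "\<bar>b a * real N\<bar> \<le> 1 * real N"
        unfolding abs_mult using b[of a] by (intro mult_mono) auto
      then have "- real N \<le> b a * real N" "b a * real N \<le> real N" by linarith+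
      then show "\<lfloor>b a * real N\<rfloor> \<in> {- int N..int N}" by (auto simp: le_floor_iff floor_le_iff)
    qed
    have close: "\<bar>b a - b' a\<bar> \<le> 1 / real N" if "a \<in> J" for a
    proof -
      have "\<bar>b a * real N - of_int \<lfloor>b a * real N\<rfloor>\<bar> \<le> 1" by linarith
      moreover have "b a - b' a = (b a * real N - of_int \<lfloor>b a * real N\<rfloor>) / real N"
        using that N0 by (simp add: b'_def field_simps)
      ultimately show ?thesis using N0 by (simp add: abs_divide divide_right_mono)
    qed
    have "\<bar>\<bar>blinfun_apply (f b) y\<bar> powr p - \<bar>blinfun_apply (f b') y\<bar> powr p\<bar> < \<epsilon>"
      if y: "y \<in> A \<or> norm y \<le> 1" for y
    proof (rule \<delta>(2))
      show "\<bar>blinfun_apply (f b') y\<bar> \<le> R" "\<bar>blinfun_apply (f b) y\<bar> \<le> R"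
        using f_R[of b' y] f_R[of b y] y b grid_le[OF b'] by blast+
      have "blinfun_apply (f b) y - blinfun_apply (f b') y = blinfun_apply (f (\<lambda>a. b a - b' a)) y"
        by (simp add: f left_diff_distrib sum_subtractf)
      moreover have "\<bar>blinfun_apply (f (\<lambda>a. b a - b' a)) y\<bar> \<le> d * (1 / real N * (L + 1))"
      proof (rule f_le[OF close])
        show "\<bar>coord a y\<bar> \<le> L + 1" if "a \<in> J" for a
          using y coord_A[OF that, of y] abs_coord_le[of a y] that J L by force
      qed
      moreover have "d * (1 / real N * (L + 1)) = R / real N" by (simp add: R_def)
      moreover have "R / real N < \<delta>" using N N0 \<delta>(1) by (simp add: field_simps)
      ultimately show "\<bar>blinfun_apply (f b) y - blinfun_apply (f b') y\<bar> < \<delta>" by linarith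
    qed
    with b' show ?thesis by blast
  qed
  have "\<exists>x\<in>A. \<forall>x'\<in>A. \<bar>blinfun_apply (f b) x'\<bar> powr p \<le> \<bar>blinfun_apply (f b) x\<bar> powr p + \<epsilon>"
    if b: "b \<in> grid" for b
  proof -
    define W where "W = (\<lambda>x. \<bar>blinfun_apply (f b) x\<bar> powr p) ` A"
    have bdd: "bdd_above W"
      unfolding W_def
    proof (rule bdd_aboveI2)
      fix x assume "x \<in> A"
      then show "\<bar>blinfun_apply (f b) x\<bar> powr p \<le> R powr p"
        using f_R[of b x] grid_le[OF b] p by (intro powr_mono2) auto
    qed
    have "Sup W - \<epsilon> < Sup W" using \<epsilon> by simp
    then obtain x where x: "x \<in> A" "Sup W - \<epsilon> < \<bar>blinfun_apply (f b) x\<bar> powr p"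
      using less_cSupD[of W "Sup W - \<epsilon>"] A(2) by (auto simp: W_def)
    have "\<bar>blinfun_apply (f b) x'\<bar> powr p \<le> Sup W" if "x' \<in> A" for x'
      using that bdd by (intro cSup_upper) (auto simp: W_def)
    with x show ?thesis by (smt (verit))
  qed
  then obtain X where X: "\<And>b. b \<in> grid \<Longrightarrow> X b \<in> A"
    "\<And>b x'. b \<in> grid \<Longrightarrow> x' \<in> A \<Longrightarrow> \<bar>blinfun_apply (f b) x'\<bar> powr p \<le> \<bar>blinfun_apply (f b) (X b)\<bar> powr p + \<epsilon>"
    by metis
  \<comment> \<open>The summand \<open>\<epsilon>\<close> lets the response exist although the supremum over the unit ball need not be
    attained.\<close>
  define v where "v b y = c * \<bar>blinfun_apply (f b) y\<bar> powr p - \<bar>blinfun_apply (f b) (X b)\<bar> powr p + \<epsilon>" for b y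
  have v_bound: "\<bar>v b y\<bar> \<le> c * R powr p + R powr p + \<epsilon>" if "b \<in> grid" "y \<in> cball 0 1" for b y
  proof -
    have "\<bar>blinfun_apply (f b) y\<bar> powr p \<le> R powr p" "\<bar>blinfun_apply (f b) (X b)\<bar> powr p \<le> R powr p"
      using f_R[of b y] f_R[of b "X b"] grid_le X(1) that p by (auto intro!: powr_mono2)
    moreover from this have "c * \<bar>blinfun_apply (f b) y\<bar> powr p \<le> c * R powr p"
      using c by (intro mult_left_mono) auto
    moreover have "0 \<le> c * \<bar>blinfun_apply (f b) y\<bar> powr p" "0 \<le> \<bar>blinfun_apply (f b) (X b)\<bar> powr p"
      using c by auto
    ultimately show ?thesis using \<epsilon> unfolding v_def by linarith
  qed
  have response: "\<exists>y\<in>cball 0 1. 0 \<le> (\<Sum>b\<in>grid. t b * v b y)" if t: "\<And>b. 0 \<le> t b" for t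
  proof (rule ccontr)
    assume contra: "\<not> ?thesis"
    define S where "S = (\<Sum>b\<in>grid. t b * \<bar>blinfun_apply (f b) (X b)\<bar> powr p)"
    define T where "T = (\<Sum>b\<in>grid. t b)"
    have v_sum: "(\<Sum>b\<in>grid. t b * v b y) = c * (\<Sum>b\<in>grid. t b * \<bar>blinfun_apply (f b) y\<bar> powr p) - S + T * \<epsilon>" for y
      by (simp add: v_def S_def T_def algebra_simps sum.distrib sum_subtractf sum_distrib_left sum_distrib_right)
    have neg: "c * (\<Sum>b\<in>grid. t b * \<bar>blinfun_apply (f b) y\<bar> powr p) < S - T * \<epsilon>" if "norm y \<le> 1" for y
    proof -
      have "y \<in> cball 0 1" using that by simp
      then have "(\<Sum>b\<in>grid. t b * v b y) < 0" using contra not_le by blast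
      then show ?thesis using v_sum[of y] by linarith
    qed
    define M where "M = (S - T * \<epsilon>) / c"
    have "0 < S - T * \<epsilon>" using neg[of 0] p by simp
    then have M: "M > 0" using c by (simp add: M_def)
    have "(\<Sum>b\<in>grid. t b * \<bar>blinfun_apply (f b) y\<bar> powr p) \<le> M * norm y powr p" for y
    proof (cases "y = 0")
      case False
      have scale: "\<bar>blinfun_apply (f b) (y /\<^sub>R norm y)\<bar> powr p = \<bar>blinfun_apply (f b) y\<bar> powr p / norm y powr p" for b
        by (simp add: blinfun.scaleR_right inverse_eq_divide abs_divide powr_divide)
      have "c * (\<Sum>b\<in>grid. t b * (\<bar>blinfun_apply (f b) y\<bar> powr p / norm y powr p)) < S - T * \<epsilon>"
        using neg[of "y /\<^sub>R norm y"] False by (simp add: scale)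
      then have "c * ((\<Sum>b\<in>grid. t b * \<bar>blinfun_apply (f b) y\<bar> powr p) / norm y powr p) < S - T * \<epsilon>"
        by (simp add: sum_divide_distrib)
      then show ?thesis using False c by (simp add: M_def field_simps)
    qed (use p M in simp)
    moreover obtain h :: "('a \<Rightarrow> real) \<Rightarrow> nat" where h: "inj_on h grid"
      using fin_grid finite_imp_inj_to_nat_seg by metis
    ultimately have "S \<le> c * M"
    proof -
      have re: "(\<Sum>i\<in>h ` grid. u (inv_into grid h i)) = sum u grid" for u :: "_ \<Rightarrow> real"
        using h by (simp add: sum.reindex)
      have "(\<Sum>i\<in>h ` grid. t (inv_into grid h i) *
          \<bar>blinfun_apply (f (inv_into grid h i)) (X (inv_into grid h i))\<bar> powr p) \<le> c * M"
      proof (rule summing_boundD[OF A(1)])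
        fix y
        show "(\<Sum>i\<in>h ` grid. t (inv_into grid h i) * \<bar>blinfun_apply (f (inv_into grid h i)) y\<bar> powr p) \<le> M * norm y powr p"
          using re[of "\<lambda>b. t b * \<bar>blinfun_apply (f b) y\<bar> powr p"]
            \<open>\<And>y. (\<Sum>b\<in>grid. t b * \<bar>blinfun_apply (f b) y\<bar> powr p) \<le> M * norm y powr p\<close> by simp
      qed (use fin_grid M t f_tail X(1) in \<open>auto simp: inv_into_into\<close>)
      then show ?thesis
        using re[of "\<lambda>b. t b * \<bar>blinfun_apply (f b) (X b)\<bar> powr p"] by (simp add: S_def)
    qed
    then have "T * \<epsilon> \<le> 0" using c by (simp add: M_def)
    moreover have "T \<ge> 0" unfolding T_def using t by (intro sum_nonneg)
    ultimately have "T = 0" using \<epsilon> by (simp add: mult_le_0_iff)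
    then have "\<forall>b\<in>grid. t b = 0"
      unfolding T_def using fin_grid t by (simp add: sum_nonneg_eq_0_iff)
    then have "S = 0" by (simp add: S_def)
    with \<open>0 < S - T * \<epsilon>\<close> \<open>T = 0\<close> show False by simp
  qed
  obtain T y where T: "T > 0" "\<And>i. i < T \<Longrightarrow> y i \<in> cball 0 (1::real)"
    "\<And>b. b \<in> grid \<Longrightarrow> - \<epsilon> \<le> (\<Sum>i<T. v b (y i)) / real T"
    by (rule approachability[of grid "cball 0 1" v "c * R powr p + R powr p + \<epsilon>" \<epsilon>])
       (use fin_grid v_bound response \<epsilon> in auto)
  define avg where "avg b = (\<Sum>i<T. \<bar>blinfun_apply (f b) (y i)\<bar> powr p) / real T" for b
  have final: "\<bar>blinfun_apply (f b) x\<bar> powr p \<le> c * avg b + e"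
    if b: "\<And>a. a \<in> J \<Longrightarrow> \<bar>b a\<bar> \<le> 1" and x: "x \<in> A" for b x
  proof -
    obtain b' where b': "b' \<in> grid" "\<And>y. y \<in> A \<or> norm y \<le> 1 \<Longrightarrow>
      \<bar>\<bar>blinfun_apply (f b) y\<bar> powr p - \<bar>blinfun_apply (f b') y\<bar> powr p\<bar> < \<epsilon>"
      using near_grid[of b] b by blast
    have "(\<Sum>i<T. v b' (y i)) = c * (\<Sum>i<T. \<bar>blinfun_apply (f b') (y i)\<bar> powr p)
        - real T * \<bar>blinfun_apply (f b') (X b')\<bar> powr p + real T * \<epsilon>"
      by (simp add: v_def sum.distrib sum_subtractf sum_distrib_left)
    then have "(\<Sum>i<T. v b' (y i)) / real T = c * avg b' - \<bar>blinfun_apply (f b') (X b')\<bar> powr p + \<epsilon>"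
      using T(1) by (simp add: avg_def add_divide_distrib diff_divide_distrib)
    then have 1: "\<bar>blinfun_apply (f b') (X b')\<bar> powr p \<le> c * avg b' + 2 * \<epsilon>"
      using T(3)[OF b'(1)] by linarith
    have "avg b' \<le> (\<Sum>i<T. \<bar>blinfun_apply (f b) (y i)\<bar> powr p + \<epsilon>) / real T"
      unfolding avg_def
    proof (intro divide_right_mono sum_mono)
      fix i assume "i \<in> {..<T}"
      then have "norm (y i) \<le> 1" using T(2)[of i] by simp
      then show "\<bar>blinfun_apply (f b') (y i)\<bar> powr p \<le> \<bar>blinfun_apply (f b) (y i)\<bar> powr p + \<epsilon>"
        using b'(2)[of "y i"] by linarith
    qed simp
    also have "\<dots> = avg b + \<epsilon>"
      using T(1) by (simp add: avg_def sum.distrib add_divide_distrib)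
    finally have "c * avg b' \<le> c * (avg b + \<epsilon>)" using c by (intro mult_left_mono) auto
    moreover have "\<bar>blinfun_apply (f b) x\<bar> powr p \<le> \<bar>blinfun_apply (f b') x\<bar> powr p + \<epsilon>"
      using b'(2)[of x] x by linarith
    moreover have "\<bar>blinfun_apply (f b') x\<bar> powr p \<le> \<bar>blinfun_apply (f b') (X b')\<bar> powr p + \<epsilon>"
      using X(2)[OF b'(1) x] .
    ultimately have "\<bar>blinfun_apply (f b) x\<bar> powr p \<le> c * avg b + (c + 4) * \<epsilon>"
      using 1 by (simp add: algebra_simps)
    also have "(c + 4) * \<epsilon> = e" using c by (simp add: \<epsilon>_def)
    finally show ?thesis .
  qed
  have "\<forall>b. \<forall>x\<in>A. (\<forall>a\<in>J. \<bar>b a\<bar> \<le> 1) \<longrightarrow>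
      \<bar>\<Sum>a\<in>J. b a * coord a x\<bar> powr p
        \<le> c * ((\<Sum>i<T. \<bar>\<Sum>a\<in>J. b a * coord a (y i)\<bar> powr p) / real T) + e"
    using final by (simp add: avg_def f)
  moreover have "\<forall>i<T. norm (y i) \<le> 1" using T(2) by simp
  ultimately show ?thesis using T(1) by blast
qed

text \<open>The additive error in the domination is absorbed by small multiples of the atoms of the block, on
  which a functional with largest coefficient \<open>1\<close> has \<open>p\<close>-th power sum at least \<open>\<kappa>\<close>. The domination
  becomes homogeneous, so it extends from the cube to all coefficients, and the bipolar theorem turns
  it into a representation of \<open>proj J x\<close>.\<close>

lemma block_representation:
  assumes p: "1 \<le> p" and A: "summing_bound p A (tail_functionals F) c" "A \<noteq> {}" and c: "0 < c"
    and J: "finite J" "J \<subseteq> \<Gamma> - F"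
  obtains zs where "(\<Sum>z\<leftarrow>zs. norm z powr p) \<le> 2 * c" "\<And>z. z \<in> set zs \<Longrightarrow> proj J z = z"
    "\<And>x. x \<in> A \<Longrightarrow> \<exists>l\<in>dual_ball p. proj J x = (\<Sum>i<length zs. l i *\<^sub>R zs ! i)"
proof -
  define \<kappa> where "\<kappa> = c / (real (card J) + 1)"
  have \<kappa>: "\<kappa> > 0" using c by (simp add: \<kappa>_def)
  obtain T :: nat and y :: "nat \<Rightarrow> 'a" where T: "T > 0" "\<forall>i<T. norm (y i) \<le> 1"
    "\<forall>b. \<forall>x\<in>A. (\<forall>a\<in>J. \<bar>b a\<bar> \<le> 1) \<longrightarrow>
      \<bar>\<Sum>a\<in>J. b a * coord a x\<bar> powr p
        \<le> c * ((\<Sum>i<T. \<bar>\<Sum>a\<in>J. b a * coord a (y i)\<bar> powr p) / real T) + \<kappa>"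
    using block_domination[OF p A c J \<kappa>] by (elim exE conjE) (rule that)
  obtain js where js: "set js = J" "distinct js" using finite_distinct_list[OF J(1)] by blast
  define zs where "zs = map (\<lambda>i. ((c / T) powr (1 / p)) *\<^sub>R proj J (y i)) [0..<T]
    @ map (\<lambda>a. (\<kappa> powr (1 / p)) *\<^sub>R a) js"
  have J\<Gamma>: "J \<subseteq> \<Gamma>" using J by auto
  have sum_zs: "(\<Sum>z\<leftarrow>zs. h z) = (\<Sum>i<T. h (((c / T) powr (1 / p)) *\<^sub>R proj J (y i)))
    + (\<Sum>a\<in>J. h ((\<kappa> powr (1 / p)) *\<^sub>R a))" for h :: "'a \<Rightarrow> real"
    using js by (simp add: zs_def o_def interv_sum_list_conv_sum_set_nat atLeast0LessThan sum_list_distinct_conv_sum_set)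
  have norm_zs: "(\<Sum>z\<leftarrow>zs. norm z powr p) \<le> 2 * c"
  proof -
    have "norm (((c / T) powr (1 / p)) *\<^sub>R proj J (y i)) powr p \<le> c / T" if "i < T" for i
    proof -
      have "norm (proj J (y i)) \<le> 1"
        using norm_proj_le[OF J(1) J\<Gamma>, of "y i"] T(2) that order_trans by blast
      then have "norm (proj J (y i)) powr p \<le> 1" using p by (simp add: powr_le1)
      then have "c / T * norm (proj J (y i)) powr p \<le> c / T" using c by (intro mult_left_le) auto
      then show ?thesis using p c by (simp add: powr_mult powr_powr)
    qed
    then have "(\<Sum>i<T. norm (((c / T) powr (1 / p)) *\<^sub>R proj J (y i)) powr p) \<le> (\<Sum>i<T. c / T)"
      by (intro sum_mono) auto
    also have "\<dots> = c" using T(1) by simp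
    finally have 1: "(\<Sum>i<T. norm (((c / T) powr (1 / p)) *\<^sub>R proj J (y i)) powr p) \<le> c" .
    have "(\<Sum>a\<in>J. norm ((\<kappa> powr (1 / p)) *\<^sub>R a) powr p) = (\<Sum>a\<in>J. \<kappa>)"
      using J\<Gamma> p \<kappa> by (intro sum.cong) (auto simp: norm_atom powr_powr subset_iff)
    also have "\<dots> \<le> c" using c by (simp add: \<kappa>_def field_simps)
    finally show ?thesis using 1 by (simp add: sum_zs)
  qed
  have proj_zs: "proj J z = z" if "z \<in> set zs" for z
  proof -
    have "proj J a = a" if "a \<in> J" for a
    proof -
      have "proj J a = (\<Sum>b\<in>J. if b = a then a else 0)"
        unfolding proj_def using J\<Gamma> that by (intro sum.cong) (auto simp: biorthogonal subset_iff)
      then show ?thesis using J(1) that by simp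
    qed
    then show ?thesis
      using \<open>z \<in> set zs\<close> js J(1) J\<Gamma> by (auto simp: zs_def proj_scaleR proj_idem)
  qed
  have dom: "\<bar>\<Sum>a\<in>J. r a * coord a x\<bar> powr p \<le> (\<Sum>i<length zs. \<bar>\<Sum>a\<in>J. r a * coord a (zs ! i)\<bar> powr p)"
    if x: "x \<in> A" for r x
  proof -
    define h where "h b z = \<bar>\<Sum>a\<in>J. b a * coord a z\<bar> powr p" for b z
    show ?thesis
    proof (cases "\<forall>a\<in>J. r a = 0")
      case True
      then show ?thesis using p by (simp add: sum_nonneg)
    next
      case False
      define m where "m = Max ((\<lambda>a. \<bar>r a\<bar>) ` J)"
      have ne: "J \<noteq> {}" using False by auto
      have le_m: "\<bar>r a\<bar> \<le> m" if "a \<in> J" for a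
        unfolding m_def using that J(1) by (intro Max_ge) auto
      have "m \<in> (\<lambda>a. \<bar>r a\<bar>) ` J" unfolding m_def using J(1) ne by (intro Max_in) auto
      then obtain a0 where a0: "a0 \<in> J" "\<bar>r a0\<bar> = m" by auto
      have m: "m > 0" using False le_m by force
      define b where "b a = r a / m" for a
      have h_b: "h r z = m powr p * h b z" for z
      proof -
        have "(\<Sum>a\<in>J. r a * coord a z) = m * (\<Sum>a\<in>J. b a * coord a z)"
          using m by (simp add: b_def sum_distrib_left)
        then show ?thesis using m by (simp add: h_def abs_mult powr_mult)
      qed
      have b1: "\<bar>b a\<bar> \<le> 1" if "a \<in> J" for a
        using le_m[OF that] m by (simp add: b_def)
      have "h b x \<le> c * ((\<Sum>i<T. h b (y i)) / T) + \<kappa>"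
        unfolding h_def using T(3) b1 x by blast
      also have "c * ((\<Sum>i<T. h b (y i)) / T) = (\<Sum>i<T. c / T * h b (y i))"
        by (simp add: sum_distrib_left sum_divide_distrib)
      also have "\<dots> = (\<Sum>i<T. h b (((c / T) powr (1 / p)) *\<^sub>R proj J (y i)))"
      proof (intro sum.cong refl)
        fix i
        have "(\<Sum>a\<in>J. b a * coord a (((c / T) powr (1 / p)) *\<^sub>R proj J (y i)))
            = ((c / T) powr (1 / p)) * (\<Sum>a\<in>J. b a * coord a (y i))"
          unfolding sum_distrib_left using J(1) J\<Gamma>
          by (intro sum.cong) (auto simp: blinfun.scaleR_right coord_proj subset_iff)
        then show "c / T * h b (y i) = h b (((c / T) powr (1 / p)) *\<^sub>R proj J (y i))"
          using c p by (simp add: h_def abs_mult powr_mult powr_powr)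
      qed
      also have "\<kappa> \<le> (\<Sum>a\<in>J. h b ((\<kappa> powr (1 / p)) *\<^sub>R a))"
      proof -
        have hb: "h b ((\<kappa> powr (1 / p)) *\<^sub>R a) = \<kappa> * \<bar>b a\<bar> powr p" if "a \<in> J" for a
        proof -
          have "(\<Sum>a'\<in>J. b a' * coord a' ((\<kappa> powr (1 / p)) *\<^sub>R a))
            = (\<Sum>a'\<in>J. if a' = a then \<kappa> powr (1 / p) * b a else 0)"
            using J\<Gamma> that by (intro sum.cong) (auto simp: blinfun.scaleR_right biorthogonal subset_iff)
          also have "\<dots> = \<kappa> powr (1 / p) * b a" using J(1) that by simp
          finally show ?thesis using \<kappa> p by (simp add: h_def abs_mult powr_mult powr_powr)
        qed
        have "\<bar>b a0\<bar> = 1" using a0 m by (simp add: b_def)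
        then have "\<kappa> = h b ((\<kappa> powr (1 / p)) *\<^sub>R a0)" using hb[OF a0(1)] by simp
        also have "\<dots> \<le> (\<Sum>a\<in>J. h b ((\<kappa> powr (1 / p)) *\<^sub>R a))"
          using a0 J(1) by (intro member_le_sum) (auto simp: h_def)
        finally show ?thesis .
      qed
      finally have "h b x \<le> (\<Sum>z\<leftarrow>zs. h b z)" by (simp add: sum_zs)
      then have "m powr p * h b x \<le> m powr p * (\<Sum>z\<leftarrow>zs. h b z)"
        by (intro mult_left_mono) auto
      then have "h r x \<le> (\<Sum>z\<leftarrow>zs. h r z)"
        by (simp add: h_b sum_list_const_mult)
      also have "\<dots> = (\<Sum>i<length zs. h r (zs ! i))"
        by (simp add: sum_list_sum_nth atLeast0LessThan)
      finally show ?thesis unfolding h_def .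
    qed
  qed
  have rep: "\<exists>l\<in>dual_ball p. proj J x = (\<Sum>i<length zs. l i *\<^sub>R zs ! i)" if x: "x \<in> A" for x
  proof -
    obtain l where l: "l \<in> dual_ball p"
      "\<And>a. a \<in> J \<Longrightarrow> coord a x = (\<Sum>i<length zs. l i * coord a (zs ! i))"
      using dual_ball_interpolation[OF p J(1) dom[OF x]] by metis
    have "coord a x = coord a (\<Sum>i<length zs. l i *\<^sub>R zs ! i)" if "a \<in> J" for a
      using l(2)[OF that] by (simp add: blinfun.sum_right blinfun.scaleR_right)
    then have "proj J x = proj J (\<Sum>i<length zs. l i *\<^sub>R zs ! i)"
      unfolding proj_def by (intro sum.cong) auto
    also have "\<dots> = (\<Sum>i<length zs. l i *\<^sub>R zs ! i)"
      unfolding proj_sum proj_scaleR by (intro sum.cong refl) (simp add: proj_zs)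
    finally show ?thesis using l(1) by blast
  qed
  show ?thesis using norm_zs proj_zs rep that by blast
qed

text \<open>The sets \<open>F k\<close> increase, start with the empty set, and have tail constants \<open>c k\<close>; the blocks are
  their differences. A coordinate outside all blocks vanishes on \<open>A\<close>, because its \<open>p\<close>-th power is at
  most \<open>c k\<close> for every \<open>k\<close>. So \<open>x\<close> and the glued series have the same coordinates.\<close>

lemma p_limited_representation:
  fixes A :: "'a set"
  assumes p: "1 \<le> p" and A: "p_limited p A"
  obtains X where "norm_p_summable p X"
    "\<And>x. x \<in> A \<Longrightarrow> \<exists>l\<in>dual_ball p. (\<lambda>j. l j *\<^sub>R X j) sums x"
proof (cases "A = {}")
  case True
  then show ?thesis using that[of "\<lambda>_. 0"] p by (simp add: norm_p_summable_def)
next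
  case False
  obtain C where C: "0 < C" "summing_bound p A UNIV C"
    using p_limited_imp_summing_bound[OF p A] by blast
  \<comment> \<open>The factor \<open>(2 ^ Suc k) powr p\<close> compensates for the scaling of the \<open>k\<close>-th block in \<open>X0\<close>; no
    smallness is available for \<open>k = 0\<close>.\<close>
  define c where "c k = (if k = 0 then C else (1 / 2) ^ k / (2 ^ Suc k) powr p)" for k :: nat
  have c: "c k > 0" for k using C by (simp add: c_def)
  have "\<exists>F. finite F \<and> F \<subseteq> \<Gamma> \<and> summing_bound p A (tail_functionals F) (c k)" for k
    using small_tail_summing_bound[OF p C(2) C(1) c, of k] by blast
  then obtain F' where F': "\<And>k. finite (F' k)" "\<And>k. F' k \<subseteq> \<Gamma>"
    "\<And>k. summing_bound p A (tail_functionals (F' k)) (c k)" by metis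
  define F where "F k = (\<Union>j\<in>{1..k}. F' j)" for k :: nat
  have F: "finite (F k)" "F k \<subseteq> \<Gamma>" for k using F' by (auto simp: F_def)
  have incF: "F k \<subseteq> F k'" if "k \<le> k'" for k k' using that by (force simp: F_def)
  have F_0: "F 0 = {}" by (simp add: F_def)
  have F_bound: "summing_bound p A (tail_functionals (F k)) (c k)" for k
  proof (cases "k = 0")
    case True
    then show ?thesis using summing_bound_mono[OF C(2), of "tail_functionals (F k)" "c k"] by (simp add: c_def)
  next
    case False
    then have "F' k \<subseteq> F k" by (force simp: F_def)
    then show ?thesis
      by (intro summing_bound_mono[OF F'(3)] tail_functionals_antimono) auto
  qed
  define J where "J k = F (Suc k) - F k" for k
  have J: "finite (J k)" "J k \<subseteq> \<Gamma> - F k" "J k \<subseteq> \<Gamma>" for k using F by (auto simp: J_def)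
  define R where "R k zs \<longleftrightarrow> (\<Sum>z\<leftarrow>zs. norm z powr p) \<le> 2 * c k \<and>
    (\<forall>x\<in>A. \<exists>l\<in>dual_ball p. proj (J k) x = (\<Sum>i<length zs. l i *\<^sub>R zs ! i))" for k zs
  have "\<exists>zs. R k zs" for k
    using block_representation[OF p F_bound False c J(1,2), of k] unfolding R_def by metis
  then obtain zs where zs: "\<And>k. R k (zs k)" by metis
  define Z where "Z k i = (if i < length (zs k) then zs k ! i else 0)" for k i
  define X0 where "X0 = (\<lambda>(k, i). (2 ^ Suc k :: real) *\<^sub>R Z k i)"
  have X0_summable: "(\<lambda>z. norm (X0 z) powr p) summable_on UNIV"
  proof -
    define g where "g k = (2 ^ Suc k) powr p * (\<Sum>z\<leftarrow>zs k. norm z powr p)" for k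
    have "((\<lambda>i. norm (X0 (k, i)) powr p) has_sum g k) UNIV" for k
    proof (rule has_sum_finite_neutralI)
      have "g k = (\<Sum>i<length (zs k). (2 ^ Suc k) powr p * norm (zs k ! i) powr p)"
        by (simp add: g_def sum_list_sum_nth atLeast0LessThan sum_distrib_left)
      also have "\<dots> = (\<Sum>i<length (zs k). norm (X0 (k, i)) powr p)"
        by (intro sum.cong) (auto simp: X0_def Z_def powr_mult norm_power simp del: power_Suc)
      finally show "g k = (\<Sum>i<length (zs k). norm (X0 (k, i)) powr p)" .
    qed (use p in \<open>auto simp: X0_def Z_def\<close>)
    moreover have "g summable_on UNIV"
    proof -
      have "summable g"
      proof (rule summable_comparison_test'[where N = 1])
        show "summable (\<lambda>k. 2 * (1 / 2) ^ k :: real)"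
          by (intro summable_mult summable_geometric) auto
        show "norm (g k) \<le> 2 * (1 / 2) ^ k" if "k \<ge> 1" for k
        proof -
          have nonneg: "0 \<le> (\<Sum>z\<leftarrow>zs k. norm z powr p)" by (intro sum_list_nonneg) auto
          have "g k \<le> (2 ^ Suc k) powr p * (2 * c k)"
            unfolding g_def using zs[of k] unfolding R_def by (intro mult_left_mono) auto
          also have "\<dots> = 2 * (1 / 2) ^ k" using that by (simp add: c_def del: power_Suc)
          finally show ?thesis using nonneg by (simp add: g_def)
        qed
      qed
      moreover have "g k \<ge> 0" for k unfolding g_def by (intro mult_nonneg_nonneg sum_list_nonneg) auto
      ultimately show ?thesis by (simp add: summable_on_UNIV_nonneg_real_iff)
    qed
    ultimately have "(\<lambda>z. norm (X0 z) powr p) summable_on (SIGMA k:UNIV. UNIV)"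
      by (intro summable_on_SigmaI) auto
    then show ?thesis by simp
  qed
  define X where "X j = X0 (prod_decode j)" for j
  have X: "norm_p_summable p X"
  proof -
    have "(\<lambda>j. norm (X j) powr p) summable_on UNIV"
      unfolding X_def using X0_summable
      by (subst summable_on_reindex_bij_betw[OF bij_prod_decode])
    then show ?thesis
      unfolding norm_p_summable_def by (subst (asm) summable_on_UNIV_nonneg_real_iff) auto
  qed
  have "\<exists>l\<in>dual_ball p. (\<lambda>j. l j *\<^sub>R X j) sums x" if x: "x \<in> A" for x
  proof -
    have "\<exists>l. l \<in> dual_ball p \<and> proj (J k) x = (\<Sum>i<length (zs k). l i *\<^sub>R zs k ! i)" for k
      using zs[of k] x unfolding R_def by blast
    then obtain l where l: "\<And>k. l k \<in> dual_ball p"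
      "\<And>k. proj (J k) x = (\<Sum>i<length (zs k). l k i *\<^sub>R zs k ! i)" by metis
    define L where "L = (\<lambda>(k, i). l k i / 2 ^ Suc k)"
    have L: "L \<in> dual_ball p" unfolding L_def by (rule dual_ball_glue[OF p l(1)])
    define f where "f z = L z *\<^sub>R X0 z" for z
    have f: "f (k, i) = l k i *\<^sub>R Z k i" for k i by (simp add: f_def L_def X0_def)
    have "f abs_summable_on UNIV"
      unfolding f_def by (rule dual_ball_abs_summable[OF p L X0_summable])
    then obtain s where s: "(f has_sum s) UNIV"
      using abs_summable_summable summable_on_def by blast
    have block_sum: "((\<lambda>i. f (k, i)) has_sum proj (J k) x) UNIV" for k
      by (rule has_sum_finite_neutralI[of "{..<length (zs k)}"]) (auto simp: f Z_def l(2))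
    have "coord a x = coord a s" if a: "a \<in> \<Gamma>" for a
    proof -
      have "((\<lambda>z. coord a (f z)) has_sum coord a s) (SIGMA k:UNIV. UNIV)"
        using has_sum_bounded_linear[OF blinfun.bounded_linear_right s, of "coord a"] by simp
      then have sum_a: "((\<lambda>k. coord a (proj (J k) x)) has_sum coord a s) UNIV"
        by (rule has_sum_SigmaD) (intro has_sum_bounded_linear[OF blinfun.bounded_linear_right] block_sum)
      have coord_J: "coord a (proj (J k) x) = (if a \<in> J k then coord a x else 0)" for k
        using J a by (intro coord_proj) auto
      have "((\<lambda>k. coord a (proj (J k) x)) has_sum coord a x) UNIV"
      proof (cases "\<exists>k. a \<in> F k")
        case True
        define K where "K = (LEAST k. a \<in> F k)"
        have K: "a \<in> F K" "\<And>k. k < K \<Longrightarrow> a \<notin> F k"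
          unfolding K_def using True by (auto intro: LeastI_ex dest: not_less_Least)
        obtain k where k: "K = Suc k" using K(1) F_0 by (cases K) auto
        have J_iff: "a \<in> J j \<longleftrightarrow> j = k" for j
        proof
          assume "a \<in> J j"
          then have "a \<in> F (Suc j)" "a \<notin> F j" by (auto simp: J_def)
          then have "\<not> Suc j < K" "\<not> K \<le> j" using K incF by blast+
          then show "j = k" using k by simp
        qed (use K k in \<open>auto simp: J_def\<close>)
        show ?thesis
          by (rule has_sum_finite_neutralI[of "{k}"]) (auto simp: coord_J J_iff)
      next
        case False
        have "(\<lambda>k. c (Suc k)) \<longlonglongrightarrow> 0"
        proof (rule tendsto_sandwich[OF _ _ tendsto_const])
          have "c (Suc k) \<le> (1 / 2) ^ Suc k" for k
          proof -
            have "1 \<le> (2 ^ Suc (Suc k) :: real) powr p"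
              using p by (intro ge_one_powr_ge_zero one_le_power) auto
            then have "(1 / 2) ^ Suc k / (2 ^ Suc (Suc k)) powr p \<le> (1 / 2) ^ Suc k / (1::real)"
              by (intro divide_left_mono) auto
            then show ?thesis by (simp add: c_def)
          qed
          then show "\<forall>\<^sub>F k in sequentially. c (Suc k) \<le> (1 / 2) ^ Suc k" by simp
          show "(\<lambda>k. (1 / 2) ^ Suc k :: real) \<longlonglongrightarrow> 0"
            by (intro LIMSEQ_Suc LIMSEQ_realpow_zero) auto
        qed (use c in \<open>simp add: less_imp_le\<close>)
        moreover have "\<bar>coord a x\<bar> powr p \<le> c (Suc k)" for k
          using False a x by (intro coord_powr_le[OF p F_bound]) auto
        ultimately have "\<bar>coord a x\<bar> powr p \<le> 0"
          by (intro LIMSEQ_le_const[of "\<lambda>k. c (Suc k)"]) auto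
        then have "coord a x = 0" by simp
        moreover have "a \<notin> J k" for k using False by (auto simp: J_def)
        ultimately show ?thesis by (simp add: coord_J)
      qed
      then show ?thesis using sum_a by (rule has_sum_unique)
    qed
    then have "x - s = 0" by (intro total) (simp add: blinfun.diff_right)
    then have "(f has_sum x) UNIV" using s by simp
    then have "((\<lambda>j. f (prod_decode j)) has_sum x) UNIV"
      by (subst has_sum_reindex_bij_betw[OF bij_prod_decode])
    then have "(\<lambda>j. (L \<circ> prod_decode) j *\<^sub>R X j) sums x"
      by (intro has_sum_imp_sums) (simp add: f_def X_def)
    moreover have "L \<circ> prod_decode \<in> dual_ball p"
      using L by (intro dual_ball_reindex inj_prod_decode)
    ultimately show ?thesis by blast
  qed
  with X show ?thesis using that by blast
qed

end

section \<open>Atoms in Banach lattices\<close>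

lemma norm_mono_nonneg:
  fixes x y :: "'a::banach_lattice"
  shows "0 \<le> x \<Longrightarrow> x \<le> y \<Longrightarrow> norm x \<le> norm y"
  using norm_mono_abs[of x y] by (simp add: abs_of_nonneg)

lemma norm_abs: "norm \<bar>x\<bar> = norm (x :: 'a::banach_lattice)"
  by (intro antisym norm_mono_abs) simp_all

text \<open>The negative part of \<open>w\<close> is dominated by \<open>e u\<close> for every \<open>e > 0\<close>, so its norm vanishes. This is
  the form in which closedness of the positive cone is needed.\<close>

lemma banach_lattice_archimedean:
  fixes w u :: "'a::banach_lattice"
  assumes u: "0 \<le> u" and le: "\<And>e. 0 < e \<Longrightarrow> - (e *\<^sub>R u) \<le> w"
  shows "0 \<le> w"
proof -
  have "norm (nprt w) \<le> 0"
  proof (rule field_le_epsilon)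
    fix e :: real assume e: "e > 0"
    define d where "d = e / (norm u + 1)"
    have d: "d > 0" using e by (simp add: d_def add_nonneg_pos)
    have du: "0 \<le> d *\<^sub>R u" using d u by (simp add: scaleR_nonneg_nonneg)
    have "- (d *\<^sub>R u) \<le> nprt w"
      unfolding nprt_def using le[OF d] du by simp
    then have "\<bar>nprt w\<bar> \<le> \<bar>d *\<^sub>R u\<bar>"
      using du by (simp add: abs_of_nonneg abs_of_nonpos) (metis minus_le_iff)
    then have "norm (nprt w) \<le> d * norm u"
      using norm_mono_abs[of "nprt w" "d *\<^sub>R u"] d by simp
    also have "\<dots> \<le> d * (norm u + 1)" using d by (intro mult_left_mono) auto
    also have "\<dots> = e" by (simp add: d_def add_nonneg_eq_0_iff)
    finally show "norm (nprt w) \<le> 0 + e" by simp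
  qed
  then show ?thesis by (simp add: zero_le_iff_zero_nprt)
qed

lemma scaleR_nonneg_imp_nonneg:
  fixes a :: "'a::banach_lattice"
  assumes "0 < a" "0 \<le> r *\<^sub>R a"
  shows "0 \<le> r"
proof (rule ccontr)
  assume "\<not> ?thesis"
  then have "r *\<^sub>R a \<le> 0" "r \<noteq> 0" using assms(1) by (auto simp: scaleR_nonpos_nonneg)
  then have "r *\<^sub>R a = 0" using assms(2) by (intro antisym)
  then show False using \<open>r \<noteq> 0\<close> assms(1) by simp
qed

lemma abs_scaleR_nonneg:
  fixes a :: "'a::banach_lattice"
  assumes "0 \<le> a"
  shows "\<bar>r *\<^sub>R a\<bar> = \<bar>r\<bar> *\<^sub>R a"
proof (cases "0 \<le> r")
  case True
  then show ?thesis using assms by (simp add: abs_of_nonneg scaleR_nonneg_nonneg)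
next
  case False
  then have "\<bar>- (r *\<^sub>R a)\<bar> = (- r) *\<^sub>R a"
    using assms scaleR_nonneg_nonneg[of "- r" a] by (subst abs_of_nonneg) auto
  then show ?thesis using False by simp
qed

definition unit_atoms :: "'a::banach_lattice set" where
  "unit_atoms = {a. lattice_atom a \<and> norm a = 1}"

lemma unit_atomD:
  assumes "a \<in> unit_atoms"
  shows "0 < a" "0 \<le> a" "norm a = 1" "0 \<le> y \<Longrightarrow> y \<le> a \<Longrightarrow> \<exists>c. y = c *\<^sub>R a"
  using assms by (auto simp: unit_atoms_def lattice_atom_def)

lemma lattice_atom_normalize:
  assumes b: "lattice_atom (b :: 'a::banach_lattice)"
  shows "b /\<^sub>R norm b \<in> unit_atoms"
proof -
  have b0: "0 < b" "norm b > 0" using b by (auto simp: lattice_atom_def)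
  have "0 < b /\<^sub>R norm b" using b0 by (auto simp: less_le intro!: scaleR_nonneg_nonneg)
  moreover have "\<exists>c. y = c *\<^sub>R (b /\<^sub>R norm b)" if y: "0 \<le> y" "y \<le> b /\<^sub>R norm b" for y
  proof -
    have "norm b *\<^sub>R y \<le> b"
      using scaleR_left_mono[OF y(2), of "norm b"] b0 by simp
    moreover have "0 \<le> norm b *\<^sub>R y" using y b0 by (simp add: scaleR_nonneg_nonneg)
    ultimately obtain c where c: "norm b *\<^sub>R y = c *\<^sub>R b" using b by (auto simp: lattice_atom_def)
    have "y = (norm b *\<^sub>R y) /\<^sub>R norm b" using b0 by simp
    also have "\<dots> = c *\<^sub>R (b /\<^sub>R norm b)" unfolding c by simp
    finally show ?thesis by blast
  qed
  ultimately show ?thesis using b0 by (auto simp: unit_atoms_def lattice_atom_def)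
qed

text \<open>The coefficient of the atom \<open>a\<close> in a positive vector, that is, in its projection to the band
  spanned by \<open>a\<close>.\<close>

definition pos_coord :: "'a::banach_lattice \<Rightarrow> 'a \<Rightarrow> real" where
  "pos_coord a x = Sup {t. 0 \<le> t \<and> t *\<^sub>R a \<le> x}"

definition atom_coord :: "'a::banach_lattice \<Rightarrow> 'a \<Rightarrow> real" where
  "atom_coord a x = pos_coord a (pprt x) - pos_coord a (- nprt x)"

context
  fixes a :: "'a::banach_lattice"
  assumes a: "a \<in> unit_atoms"
begin

lemma multiple_le_norm:
  assumes "0 \<le> t" "t *\<^sub>R a \<le> x"
  shows "t \<le> norm x"
  using norm_mono_nonneg[OF _ assms(2)] assms(1) unit_atomD[OF a] by (simp add: scaleR_nonneg_nonneg)

lemma pos_coord_upper: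
  assumes "0 \<le> t" "t *\<^sub>R a \<le> x"
  shows "t \<le> pos_coord a x"
  unfolding pos_coord_def using assms
  by (intro cSup_upper bdd_aboveI[of _ "norm x"]) (auto intro: multiple_le_norm)

lemma pos_coord_nonneg: "0 \<le> x \<Longrightarrow> 0 \<le> pos_coord a x"
  by (rule pos_coord_upper) auto

lemma pos_coord_le_norm: "0 \<le> x \<Longrightarrow> pos_coord a x \<le> norm x"
  unfolding pos_coord_def by (intro cSup_least) (auto intro: multiple_le_norm exI[of _ 0])

lemma pos_coord_scaleR_le:
  assumes x: "0 \<le> x"
  shows "pos_coord a x *\<^sub>R a \<le> x"
proof -
  have "0 \<le> x - pos_coord a x *\<^sub>R a"
  proof (rule banach_lattice_archimedean)
    show "0 \<le> a" using unit_atomD[OF a] by blast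
    fix e :: real assume e: "0 < e"
    have "{t. 0 \<le> t \<and> t *\<^sub>R a \<le> x} \<noteq> {}" using x by (auto intro: exI[of _ 0])
    moreover have "pos_coord a x - e < Sup {t. 0 \<le> t \<and> t *\<^sub>R a \<le> x}"
      using e by (simp add: pos_coord_def)
    ultimately obtain t where t: "pos_coord a x - e < t" "t *\<^sub>R a \<le> x"
      using less_cSupD by (metis (no_types, lifting) mem_Collect_eq)
    then have "(pos_coord a x - e) *\<^sub>R a \<le> t *\<^sub>R a"
      using \<open>0 \<le> a\<close> by (intro scaleR_right_mono) auto
    then have "(pos_coord a x - e) *\<^sub>R a \<le> x" using t(2) by (rule order_trans)
    then show "- (e *\<^sub>R a) \<le> x - pos_coord a x *\<^sub>R a"
      by (simp add: scaleR_diff_left algebra_simps)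
  qed
  then show ?thesis by simp
qed

text \<open>Additivity is the Riesz decomposition property: a multiple \<open>t a \<le> x + y\<close> splits into a part below
  \<open>x\<close> and a part below \<open>y\<close>, and since \<open>a\<close> is an atom both parts are multiples of \<open>a\<close>.\<close>

lemma pos_coord_add:
  assumes x: "0 \<le> x" and y: "0 \<le> y"
  shows "pos_coord a (x + y) = pos_coord a x + pos_coord a y"
proof (rule antisym)
  have a0: "0 < a" "0 \<le> a" using unit_atomD[OF a] by auto
  define t where "t = pos_coord a (x + y)"
  have t: "0 \<le> t" "t *\<^sub>R a \<le> x + y"
    unfolding t_def using x y by (auto intro: pos_coord_nonneg pos_coord_scaleR_le)
  define u where "u = inf (t *\<^sub>R a) x"
  have ta: "0 \<le> t *\<^sub>R a" using t a0 by (simp add: scaleR_nonneg_nonneg)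
  have u: "0 \<le> u" "u \<le> t *\<^sub>R a" "u \<le> x" using x ta by (auto simp: u_def)
  have v: "t *\<^sub>R a - u \<le> y"
  proof -
    have "t *\<^sub>R a - y \<le> u"
      unfolding u_def using t y by (intro inf_greatest) (simp_all add: algebra_simps)
    then show ?thesis by (simp add: algebra_simps)
  qed
  obtain r where r: "u = r *\<^sub>R a"
  proof (cases "t = 0")
    case True
    then have "u = 0 *\<^sub>R a" using u by auto
    then show ?thesis using that by blast
  next
    case False
    then have t0: "t > 0" using t by simp
    have "u /\<^sub>R t \<le> a" using scaleR_left_mono[OF u(2), of "inverse t"] t0 by simp
    moreover have "0 \<le> u /\<^sub>R t" using u t0 by (simp add: scaleR_nonneg_nonneg)
    ultimately obtain c where "u /\<^sub>R t = c *\<^sub>R a" using unit_atomD(4)[OF a] by blast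
    then have "u = (t * c) *\<^sub>R a" using t0 by (metis divideR_right less_irrefl scaleR_scaleR)
    then show ?thesis using that by blast
  qed
  have r0: "0 \<le> r" using u(1) r a0 scaleR_nonneg_imp_nonneg by blast
  have "0 \<le> (t - r) *\<^sub>R a" using u(2) r by (simp add: scaleR_diff_left)
  then have tr: "0 \<le> t - r" using a0 scaleR_nonneg_imp_nonneg by blast
  have "r \<le> pos_coord a x" using r0 u(3) r by (intro pos_coord_upper) auto
  moreover have "t - r \<le> pos_coord a y" using tr v r by (intro pos_coord_upper) (auto simp: scaleR_diff_left)
  ultimately show "pos_coord a (x + y) \<le> pos_coord a x + pos_coord a y" by (simp add: t_def)
  show "pos_coord a x + pos_coord a y \<le> pos_coord a (x + y)"
    using x y by (intro pos_coord_upper)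
      (auto simp: scaleR_add_left pos_coord_nonneg intro!: add_mono pos_coord_scaleR_le)
qed

lemma pos_coord_scaleR:
  assumes x: "0 \<le> x" and r: "0 \<le> r"
  shows "pos_coord a (r *\<^sub>R x) = r * pos_coord a x"
proof (cases "r = 0")
  case True
  then show ?thesis using pos_coord_le_norm[of 0] pos_coord_nonneg[of 0] by simp
next
  case False
  have le: "s * pos_coord a y \<le> pos_coord a (s *\<^sub>R y)" if "0 \<le> y" "0 \<le> s" for s y
    using that scaleR_left_mono[OF pos_coord_scaleR_le[OF that(1)] that(2)]
    by (intro pos_coord_upper) (auto simp: pos_coord_nonneg)
  have r0: "r > 0" using False r by simp
  have "inverse r * pos_coord a (r *\<^sub>R x) \<le> pos_coord a x"
    using le[of "r *\<^sub>R x" "inverse r"] x r0 by (simp add: scaleR_nonneg_nonneg)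
  then have "pos_coord a (r *\<^sub>R x) \<le> r * pos_coord a x" using r0 by (simp add: field_simps)
  with le[OF x r] show ?thesis by simp
qed

lemma atom_coord_diff:
  assumes "0 \<le> u" "0 \<le> v"
  shows "atom_coord a (u - v) = pos_coord a u - pos_coord a v"
proof -
  have "pprt (u - v) + v = u + - nprt (u - v)"
    using prts[of "u - v"] by (simp add: algebra_simps)
  then have "pos_coord a (pprt (u - v)) + pos_coord a v = pos_coord a u + pos_coord a (- nprt (u - v))"
    using assms pos_coord_add by (metis neg_0_le_iff_le nprt_le_zero zero_le_pprt)
  then show ?thesis by (simp add: atom_coord_def)
qed

lemma atom_coord_nonneg_eq: "0 \<le> x \<Longrightarrow> atom_coord a x = pos_coord a x"
  using atom_coord_diff[of x 0] pos_coord_scaleR[of 0 0] by simp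

lemma bounded_linear_atom_coord: "bounded_linear (atom_coord a)"
proof (rule bounded_linear_intro[where K = 1])
  have decomp: "x = pprt x - (- nprt x)" "0 \<le> pprt x" "0 \<le> - nprt x" for x :: 'a
    using prts[of x] by auto
  fix x y :: 'a
  have "x + y = (pprt x + pprt y) - (- nprt x + - nprt y)"
  proof -
    have "x + y = (pprt x + nprt x) + (pprt y + nprt y)" using prts[of x] prts[of y] by metis
    then show ?thesis by (simp add: algebra_simps)
  qed
  then have "atom_coord a (x + y) = pos_coord a (pprt x + pprt y) - pos_coord a (- nprt x + - nprt y)"
    by (metis atom_coord_diff add_nonneg_nonneg decomp(2,3))
  then show "atom_coord a (x + y) = atom_coord a x + atom_coord a y"
    using decomp by (simp only: pos_coord_add atom_coord_def)
next
  fix x :: 'a and r :: real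
  have decomp: "x = pprt x - (- nprt x)" "0 \<le> pprt x" "0 \<le> - nprt x" using prts[of x] by auto
  have pos: "atom_coord a (s *\<^sub>R x) = s * atom_coord a x" if s: "0 \<le> s" for s
  proof -
    have "s *\<^sub>R x = s *\<^sub>R pprt x - s *\<^sub>R (- nprt x)"
      by (metis decomp(1) scaleR_diff_right)
    then have "atom_coord a (s *\<^sub>R x) = pos_coord a (s *\<^sub>R pprt x) - pos_coord a (s *\<^sub>R (- nprt x))"
      by (metis atom_coord_diff scaleR_nonneg_nonneg decomp(2,3) s)
    then show ?thesis
      using decomp s by (simp only: pos_coord_scaleR atom_coord_def) (simp add: algebra_simps)
  qed
  have neg: "atom_coord a (- y) = - atom_coord a y" for y :: 'a
    by (simp add: atom_coord_def pprt_neg nprt_neg)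
  show "atom_coord a (r *\<^sub>R x) = r *\<^sub>R atom_coord a x"
  proof (cases "0 \<le> r")
    case False
    then have "atom_coord a (- ((- r) *\<^sub>R x)) = - ((- r) * atom_coord a x)"
      unfolding neg using pos[of "- r"] by simp
    then show ?thesis by simp
  qed (simp add: pos)
  have "pos_coord a (pprt x) \<le> norm x" "pos_coord a (- nprt x) \<le> norm x"
  proof -
    have "pprt x \<le> \<bar>x\<bar>" "- nprt x \<le> \<bar>x\<bar>"
      by (simp_all add: abs_prts)
    then show "pos_coord a (pprt x) \<le> norm x" "pos_coord a (- nprt x) \<le> norm x"
      using decomp pos_coord_le_norm norm_mono_nonneg norm_abs by (metis order_trans)+
  qed
  moreover have "0 \<le> pos_coord a (pprt x)" "0 \<le> pos_coord a (- nprt x)"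
    using decomp by (auto intro: pos_coord_nonneg)
  ultimately show "norm (atom_coord a x) \<le> norm x * 1" by (simp add: atom_coord_def abs_le_iff)
qed

end

definition atom_functional :: "'a::banach_lattice \<Rightarrow> 'a \<Rightarrow>\<^sub>L real" where
  "atom_functional a = Blinfun (atom_coord a)"

lemma atom_functional_apply: "a \<in> unit_atoms \<Longrightarrow> blinfun_apply (atom_functional a) x = atom_coord a x"
  by (simp add: atom_functional_def bounded_linear_Blinfun_apply bounded_linear_atom_coord)

lemma atom_functional_nonneg_eq:
  "a \<in> unit_atoms \<Longrightarrow> 0 \<le> x \<Longrightarrow> blinfun_apply (atom_functional a) x = pos_coord a x"
  by (simp add: atom_functional_apply atom_coord_nonneg_eq)

lemma atom_functional_nonneg: "a \<in> unit_atoms \<Longrightarrow> 0 \<le> x \<Longrightarrow> 0 \<le> blinfun_apply (atom_functional a) x"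
  by (simp add: atom_functional_nonneg_eq pos_coord_nonneg)

lemma abs_atom_functional_le:
  assumes "a \<in> unit_atoms"
  shows "\<bar>blinfun_apply (atom_functional a) x\<bar> \<le> blinfun_apply (atom_functional a) \<bar>x\<bar>"
proof -
  have "0 \<le> \<bar>x\<bar> - x" "0 \<le> \<bar>x\<bar> + x" 
    using abs_ge_self[of x] add_left_mono[OF abs_ge_minus_self[of x], of x]
    by (simp_all add: add.commute)
  then show ?thesis
    using atom_functional_nonneg[OF assms, of "\<bar>x\<bar> - x"] atom_functional_nonneg[OF assms, of "\<bar>x\<bar> + x"]
    by (simp add: blinfun.diff_right blinfun.add_right abs_le_iff)
qed

text \<open>If a positive multiple of \<open>a\<close> lies below the atom \<open>b\<close>, it is a multiple of \<open>b\<close>, and the norms force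
  \<open>a = b\<close>.\<close>

lemma atom_functional_biorthogonal:
  assumes a: "a \<in> unit_atoms" and b: "b \<in> unit_atoms"
  shows "blinfun_apply (atom_functional a) b = (if a = b then 1 else 0)"
proof -
  have b0: "0 < b" "0 \<le> b" "norm b = 1" and a0: "0 < a" "0 \<le> a" "norm a = 1"
    using unit_atomD a b by auto
  have eq: "blinfun_apply (atom_functional a) b = pos_coord a b"
    using atom_functional_nonneg_eq[OF a b0(2)] .
  show ?thesis
  proof (cases "a = b")
    case True
    have "1 \<le> pos_coord a a" using pos_coord_upper[OF a, of 1 a] by simp
    moreover have "pos_coord a a \<le> 1" using pos_coord_le_norm[OF a a0(2)] a0 by simp
    ultimately show ?thesis using True eq by simp
  next
    case False
    define t where "t = pos_coord a b"
    have t: "0 \<le> t" "t *\<^sub>R a \<le> b"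
      unfolding t_def using a b0 by (auto intro: pos_coord_nonneg pos_coord_scaleR_le)
    have "0 \<le> t *\<^sub>R a" using t a0 by (simp add: scaleR_nonneg_nonneg)
    then obtain s where s: "t *\<^sub>R a = s *\<^sub>R b" using unit_atomD(4)[OF b _ t(2)] by blast
    have "0 \<le> s" using s \<open>0 \<le> t *\<^sub>R a\<close> b0 scaleR_nonneg_imp_nonneg by metis
    moreover have "norm (t *\<^sub>R a) = norm (s *\<^sub>R b)" using s by simp
    ultimately have "t = s" using t a0 b0 by simp
    then have "t = 0" using s False by auto
    then show ?thesis using False eq by (simp add: t_def)
  qed
qed

text \<open>Subtracting the part carried by \<open>F\<close> from \<open>x\<close> leaves a positive vector with the same coefficient at
  any further atom, by biorthogonality. This replaces a computation with suprema of disjoint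
  elements.\<close>

lemma sum_atom_functional_le:
  assumes "finite F" "F \<subseteq> unit_atoms" "0 \<le> x"
  shows "(\<Sum>a\<in>F. blinfun_apply (atom_functional a) x *\<^sub>R a) \<le> x"
  using assms
proof (induction F)
  case (insert a F)
  define y where "y = x - (\<Sum>b\<in>F. blinfun_apply (atom_functional b) x *\<^sub>R b)"
  have a: "a \<in> unit_atoms" using insert by auto
  have y: "0 \<le> y" using insert by (simp add: y_def)
  have "blinfun_apply (atom_functional a) (\<Sum>b\<in>F. blinfun_apply (atom_functional b) x *\<^sub>R b) = 0"
    using insert.hyps insert.prems a
    by (auto simp: blinfun.sum_right blinfun.scaleR_right atom_functional_biorthogonal subset_iff intro!: sum.neutral)
  then have "blinfun_apply (atom_functional a) x = blinfun_apply (atom_functional a) y"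
    by (simp add: y_def blinfun.diff_right)
  also have "\<dots> = pos_coord a y" using atom_functional_nonneg_eq[OF a y] .
  finally have "blinfun_apply (atom_functional a) x *\<^sub>R a \<le> y"
    using pos_coord_scaleR_le[OF a y] by simp
  then show ?case using insert.hyps by (simp add: y_def algebra_simps)
qed simp

lemma sum_abs_atom_functional_le:
  assumes "finite F" "F \<subseteq> unit_atoms"
  shows "(\<Sum>a\<in>F. \<bar>blinfun_apply (atom_functional a) x\<bar> *\<^sub>R a) \<le> \<bar>x\<bar>"
proof -
  have "(\<Sum>a\<in>F. \<bar>blinfun_apply (atom_functional a) x\<bar> *\<^sub>R a)
      \<le> (\<Sum>a\<in>F. blinfun_apply (atom_functional a) \<bar>x\<bar> *\<^sub>R a)"
    using assms by (intro sum_mono scaleR_right_mono abs_atom_functional_le) (auto dest: unit_atomD(2))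
  also have "\<dots> \<le> \<bar>x\<bar>" using assms by (intro sum_atom_functional_le) auto
  finally show ?thesis .
qed

lemma atom_functional_contractive:
  assumes "finite F" "F \<subseteq> unit_atoms"
  shows "norm (\<Sum>a\<in>F. blinfun_apply (atom_functional a) x *\<^sub>R a) \<le> norm x"
proof (rule norm_mono_abs)
  have "\<bar>\<Sum>a\<in>F. blinfun_apply (atom_functional a) x *\<^sub>R a\<bar>
      \<le> (\<Sum>a\<in>F. \<bar>blinfun_apply (atom_functional a) x *\<^sub>R a\<bar>)" by (rule sum_abs)
  also have "\<dots> = (\<Sum>a\<in>F. \<bar>blinfun_apply (atom_functional a) x\<bar> *\<^sub>R a)"
    using assms by (intro sum.cong refl abs_scaleR_nonneg) (auto dest: unit_atomD(2))
  also have "\<dots> \<le> \<bar>x\<bar>" using assms by (rule sum_abs_atom_functional_le)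
  finally show "\<bar>\<Sum>a\<in>F. blinfun_apply (atom_functional a) x *\<^sub>R a\<bar> \<le> \<bar>x\<bar>" .
qed

text \<open>If \<open>a\<close> has coefficient \<open>0\<close> in \<open>x\<close>, it has the same coefficient \<open>t\<close> in the positive and in the
  negative part of \<open>x\<close>. These parts are disjoint, so \<open>t = 0\<close>, and \<open>a\<close> has coefficient \<open>0\<close> in
  \<open>\<bar>x\<bar>\<close>. Discreteness provides an atom below \<open>\<bar>x\<bar>\<close> unless \<open>x = 0\<close>.\<close>

lemma atom_functionals_total:
  fixes x :: "'a::banach_lattice"
  assumes disc: "discrete_lattice TYPE('a)"
    and zero: "\<And>a. a \<in> unit_atoms \<Longrightarrow> blinfun_apply (atom_functional a) x = 0"
  shows "x = 0"
proof (rule ccontr)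
  assume "x \<noteq> 0"
  then have "0 < \<bar>x\<bar>" by simp
  then obtain b where b: "lattice_atom b" "b \<le> \<bar>x\<bar>"
    using disc unfolding discrete_lattice_def by blast
  have b0: "norm b > 0" using b(1) by (auto simp: lattice_atom_def)
  define a where "a = b /\<^sub>R norm b"
  have a: "a \<in> unit_atoms" unfolding a_def using b(1) by (rule lattice_atom_normalize)
  have a0: "0 < a" using unit_atomD[OF a] by blast
  define t where "t = pos_coord a (pprt x)"
  have t_eq: "pos_coord a (- nprt x) = t"
    using zero[OF a] atom_functional_apply[OF a, of x] by (simp add: t_def atom_coord_def)
  have t: "t *\<^sub>R a \<le> pprt x" "t *\<^sub>R a \<le> - nprt x"
    using pos_coord_scaleR_le[OF a, of "pprt x"] pos_coord_scaleR_le[OF a, of "- nprt x"] t_eq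
    by (simp_all add: t_def)
  \<comment> \<open>Disjointness of the two parts: \<open>pprt x - t a\<close> is still an upper bound of \<open>x\<close> and \<open>0\<close>.\<close>
  have "pprt x \<le> pprt x - t *\<^sub>R a"
  proof -
    have "x \<le> pprt x - t *\<^sub>R a" 
    proof -
      have "x = pprt x + nprt x" by (rule prts)
      also have "\<dots> \<le> pprt x - t *\<^sub>R a" using t(2) by (simp add: le_minus_iff)
      finally show ?thesis .
    qed
    moreover have "0 \<le> pprt x - t *\<^sub>R a" using t(1) by simp
    ultimately show ?thesis by (subst pprt_def) (rule sup_least)
  qed
  then have "t *\<^sub>R a \<le> 0" by simp
  then have "0 \<le> (- t) *\<^sub>R a" by simp
  then have "t \<le> 0" using a0 scaleR_nonneg_imp_nonneg by fastforce
  moreover have "pos_coord a \<bar>x\<bar> = t + t"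
    using pos_coord_add[OF a, of "pprt x" "- nprt x"] by (simp add: abs_prts t_eq t_def[symmetric])
  moreover have "norm b \<le> pos_coord a \<bar>x\<bar>"
    using b b0 by (intro pos_coord_upper[OF a]) (simp_all add: a_def)
  ultimately show False using b0 by simp
qed

text \<open>The sums with coefficients \<open>max (\<eta> a) 0\<close> increase and are dominated by the modulus of the given
  partial sums, because disjointness makes \<open>\<Sum>\<bar>\<eta> a\<bar> a\<close> at most that modulus. So the KB-property
  applies to them, and likewise to the negative parts.\<close>

lemma atoms_boundedly_complete:
  fixes \<eta> :: "'a::banach_lattice \<Rightarrow> real"
  assumes KB: "KB_space TYPE('a)"
    and G: "incseq G" "\<And>k. finite (G k)" "\<And>k. G k \<subseteq> unit_atoms"
    and bdd: "bounded (range (\<lambda>k. \<Sum>a\<in>G k. \<eta> a *\<^sub>R a))"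
  shows "convergent (\<lambda>k. \<Sum>a\<in>G k. \<eta> a *\<^sub>R a)"
proof -
  obtain B where B: "\<And>k. norm (\<Sum>a\<in>G k. \<eta> a *\<^sub>R a) \<le> B" using bdd by (auto simp: bounded_iff)
  have part: "convergent (\<lambda>k. \<Sum>a\<in>G k. \<theta> a *\<^sub>R a)"
    if \<theta>: "\<And>a. 0 \<le> \<theta> a" "\<And>a. \<theta> a \<le> \<bar>\<eta> a\<bar>" for \<theta> :: "'a \<Rightarrow> real"
  proof -
    have nonneg: "0 \<le> \<theta> a *\<^sub>R a" if "a \<in> G k" for a k
      using that G(3)[of k] \<theta>(1) by (auto intro!: scaleR_nonneg_nonneg dest: unit_atomD(2))
    have "incseq (\<lambda>k. \<Sum>a\<in>G k. \<theta> a *\<^sub>R a)"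
      using G(1,2) nonneg by (intro incseq_SucI sum_mono2) (auto dest: incseq_SucD)
    moreover have "0 \<le> (\<Sum>a\<in>G k. \<theta> a *\<^sub>R a)" for k using nonneg by (intro sum_nonneg)
    moreover have "norm (\<Sum>a\<in>G k. \<theta> a *\<^sub>R a) \<le> B" for k
    proof -
      define v where "v = (\<Sum>a\<in>G k. \<eta> a *\<^sub>R a)"
      have v: "blinfun_apply (atom_functional a) v = \<eta> a" if "a \<in> G k" for a
      proof -
        have "blinfun_apply (atom_functional a) v = (\<Sum>b\<in>G k. if b = a then \<eta> a else 0)"
          unfolding v_def blinfun.sum_right blinfun.scaleR_right using that G(3)[of k]
          by (intro sum.cong) (auto simp: atom_functional_biorthogonal subset_iff)
        then show ?thesis using that G(2) by simp
      qed
      have "(\<Sum>a\<in>G k. \<theta> a *\<^sub>R a) \<le> (\<Sum>a\<in>G k. \<bar>blinfun_apply (atom_functional a) v\<bar> *\<^sub>R a)"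
        using \<theta>(2) G(3)[of k] by (intro sum_mono scaleR_right_mono) (auto simp: v dest: unit_atomD(2))
      also have "\<dots> \<le> \<bar>v\<bar>" using G(2,3) by (rule sum_abs_atom_functional_le)
      finally have "norm (\<Sum>a\<in>G k. \<theta> a *\<^sub>R a) \<le> norm \<bar>v\<bar>"
        using nonneg by (intro norm_mono_nonneg sum_nonneg)
      then show ?thesis using B[of k] by (simp add: norm_abs v_def)
    qed
    ultimately show ?thesis using KB unfolding KB_space_def by (auto simp: bounded_iff)
  qed
  have "convergent (\<lambda>k. (\<Sum>a\<in>G k. max (\<eta> a) 0 *\<^sub>R a) - (\<Sum>a\<in>G k. max (- \<eta> a) 0 *\<^sub>R a))"
    by (intro convergent_diff part) auto
  moreover have "(\<Sum>a\<in>G k. max (\<eta> a) 0 *\<^sub>R a) - (\<Sum>a\<in>G k. max (- \<eta> a) 0 *\<^sub>R a) = (\<Sum>a\<in>G k. \<eta> a *\<^sub>R a)" for k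
    unfolding sum_subtractf[symmetric] scaleR_diff_left[symmetric]
    by (intro sum.cong) (auto simp: max_def)
  ultimately show ?thesis by simp
qed

section \<open>Discrete KB-spaces\<close>

theorem theorem2p7:
  fixes p :: real
  assumes "1 \<le> p"
    and "KB_space TYPE('a::banach_lattice)"
    and "discrete_lattice TYPE('a)"
  shows "(\<forall>A::'a set. p_limited p A \<longrightarrow> relatively_p_compact p A)
    \<and> p_GP_property p TYPE('a) \<and> weak_p_GP_property p TYPE('a)"
proof -
  interpret boundedly_complete_system "unit_atoms :: 'a set" atom_functional
  proof
    show "norm a = 1" if "a \<in> unit_atoms" for a :: 'a using unit_atomD(3)[OF that] .
    show "x = 0" if "\<And>a. a \<in> unit_atoms \<Longrightarrow> blinfun_apply (atom_functional a) x = 0" for x :: 'a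
      using assms(3) that by (rule atom_functionals_total)
    show "convergent (\<lambda>k. \<Sum>a\<in>G k. \<eta> a *\<^sub>R a)"
      if "incseq G" "\<And>k. finite (G k)" "\<And>k. G k \<subseteq> unit_atoms"
        "bounded (range (\<lambda>k. \<Sum>a\<in>G k. \<eta> a *\<^sub>R a))" for G and \<eta> :: "'a \<Rightarrow> real"
      using assms(2) that by (rule atoms_boundedly_complete)
  qed (auto simp: atom_functional_biorthogonal atom_functional_contractive)
  have both: "relatively_p_compact p A \<and> compact (closure A)" if A: "p_limited p A" for A :: "'a set"
  proof -
    obtain X where X: "norm_p_summable p X"
      "\<And>x. x \<in> A \<Longrightarrow> \<exists>l\<in>dual_ball p. (\<lambda>j. l j *\<^sub>R X j) sums x"
      using p_limited_representation[OF assms(1) A] by blast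
    define K where "K = (\<lambda>l. \<Sum>j. l j *\<^sub>R X j) ` dual_ball p"
    have K: "compact K" unfolding K_def by (rule compact_dual_ball_sums[OF assms(1) X(1)])
    have AK: "A \<subseteq> K"
    proof
      fix x assume "x \<in> A"
      then obtain l where "l \<in> dual_ball p" "(\<lambda>j. l j *\<^sub>R X j) sums x" using X(2) by blast
      then show "x \<in> K" unfolding K_def by (auto simp: sums_iff)
    qed
    have "closure A \<subseteq> K" using AK K by (simp add: closure_minimal compact_imp_closed)
    then have "compact (closure A)"
      using compact_Int_closed[OF K closed_closure, of A] by (simp add: inf.absorb2)
    moreover have "bounded A" using AK K by (meson bounded_subset compact_imp_bounded)
    moreover have "A \<subseteq> {s. \<exists>l\<in>ell_unit_ball (conjugate_exponent p). (\<lambda>j. l j *\<^sub>R X j) sums s}"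
      using X(2) dual_ball_subset_ell_unit_ball[OF assms(1)] by blast
    ultimately show ?thesis using X(1) unfolding relatively_p_compact_def by blast
  qed
  then show ?thesis unfolding p_GP_property_def weak_p_GP_property_def by blast
qed

end
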